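(* Let $\mathcal A$ be the Apollonian Window and consider the corona of its disk of curvature $-1$ (the exterior of the unit circle). For any one of the four quarters of the corona, for instance the quarter consisting of the corona disks that touch the unit circle at a point $(x,y)$ with $x\ge 0$ and $y\ge 0$, the total area of the disks in that quarter is $$A_{\rm AW}=\pi\sum_{\substack{0\le k\le n\\ \gcd(n,k)=1}}\frac{1}{\big(n^2+k^2+1\big)^2},$$ where the sum is over all pairs of integers $(n,k)$ with $0\le k\le n$ and $\gcd(n,k)=1$.
   Context: The Apollonian Window is the Apollonian disk packing generated by the exterior of the unit circle centered at the origin (regarded as a disk of curvature $-1$) and the two disks of radius $1/2$ centered at $(\pm\frac12,0)$: starting from these three mutually tangent disks (disjoint interiors, tangent boundaries), one repeatedly adjoins, for every three mutually tangent disks already present, both disks that are tangent to all three. The corona of a disk in the packing is the set of all disks of the packing tangent to it. Here the corona of the exterior disk consists of the disks of the packing that touch the unit circle from inside; in particular it contains the disks of curvature $2$ touching at $(\pm1,0)$ and the disks of curvature $3$ (centers $(0,\pm\frac23)$) touching at $(0,\pm1)$. The four quarters correspond to the four closed quarter-arcs of the unit circle cut out by the coordinate axes, each quarter including its two end disks (one of curvature $2$ and one of curvature $3$) in full. *)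

theory Defs
  imports "HOL-Analysis.Analysis"
begin

text \<open>
  The plane is \<^typ>\<open>complex\<close>, with \<open>(x, y)\<close> written \<open>Complex x y\<close>. A disk may have positive,
  zero or negative curvature: it is a closed round disk, a closed half-plane, or the closed
  exterior of a circle, represented by its set of points.
\<close>

definition half_plane :: "complex set \<Rightarrow> bool" where
  "half_plane D \<longleftrightarrow> (\<exists>a b. a \<noteq> 0 \<and> D = {z. a \<bullet> z \<le> b})"

definition disk :: "complex set \<Rightarrow> bool" where
  "disk D \<longleftrightarrow>
     (\<exists>c r. r > 0 \<and> D = cball c r) \<or> half_plane D \<or> (\<exists>c r. r > 0 \<and> D = - ball c r)"

text \<open>
  Two boundaries are tangent when they share exactly one point of the extended plane. For disks
  with disjoint interiors that point is the point at infinity only if both are half-planes, with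
  distinct parallel boundary lines; this is the second alternative.
\<close>

definition tangent :: "complex set \<Rightarrow> complex set \<Rightarrow> bool" where
  "tangent D E \<longleftrightarrow>
     interior D \<inter> interior E = {} \<and>
     ((\<exists>p. frontier D \<inter> frontier E = {p}) \<or>
      (half_plane D \<and> half_plane E \<and> frontier D \<inter> frontier E = {}))"

inductive_set apollonian_packing :: "complex set set \<Rightarrow> complex set set"
  for S :: "complex set set" where
  seed: "D \<in> S \<Longrightarrow> D \<in> apollonian_packing S"
| adjoin: "\<lbrakk>D1 \<in> apollonian_packing S; D2 \<in> apollonian_packing S; D3 \<in> apollonian_packing S;
     tangent D1 D2; tangent D2 D3; tangent D1 D3;
     disk D; tangent D D1; tangent D D2; tangent D D3\<rbrakk> \<Longrightarrow> D \<in> apollonian_packing S"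

definition exterior_disk :: "complex set" where
  "exterior_disk = - ball 0 1"

definition apollonian_window :: "complex set set" where
  "apollonian_window =
     apollonian_packing {exterior_disk, cball (Complex (1/2) 0) (1/2), cball (Complex (-1/2) 0) (1/2)}"

definition corona :: "complex set set \<Rightarrow> complex set \<Rightarrow> complex set set" where
  "corona P D = {E \<in> P. tangent E D}"

text \<open>The signs \<open>s, t \<in> {1, -1}\<close> select the quarter; \<open>s = t = 1\<close> is \<open>x \<ge> 0\<close>, \<open>y \<ge> 0\<close>.\<close>

definition quarter :: "real \<Rightarrow> real \<Rightarrow> complex set set" where
  "quarter s t =
     {E \<in> corona apollonian_window exterior_disk.
        \<exists>x y. Complex x y \<in> frontier E \<inter> sphere 0 1 \<and> s * x \<ge> 0 \<and> t * y \<ge> 0}"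

definition area :: "complex set \<Rightarrow> real" where
  "area D = measure lebesgue D"

definition coprime_pairs :: "(int \<times> int) set" where
  "coprime_pairs = {(n, k). 0 \<le> k \<and> k \<le> n \<and> gcd n k = 1}"

end

theory Submission
  imports Defs
begin

text \<open>
  A generalized disk is encoded by the vector \<open>(b, c, z)\<close> of its curvature \<open>b\<close>, the curvature \<open>c\<close>
  of its image under inversion in the unit circle, and \<open>b\<close> times its center. With respect to a
  form of Lorentz signature these vectors have norm \<open>-1\<close>, and tangent disks have product \<open>1\<close>.
  Four mutually tangent disks form a basis; exchanging one of them for the other disk tangent to
  the remaining three is a reflection. Reading off the products of a fixed disk with the disks of a
  quadruple, a reduced word of reflections makes these products grow. Hence distinct disks in the
  orbit of the initial quadruple have product at least \<open>1\<close>, and descending along the products shows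
  that three mutually tangent disks of the orbit lie in a common quadruple. So the orbit contains
  the whole packing.

  A disk of the orbit tangent to the exterior disk has integral data, so it touches the unit circle
  at a rational point \<open>(n + i k)\<^sup>2 / (n\<^sup>2 + k\<^sup>2)\<close> with coprime \<open>n, k\<close>. By Euclid's algorithm the
  packing contains a disk of curvature \<open>n\<^sup>2 + k\<^sup>2 + 1\<close> touching there, and two disks touching the
  unit circle from inside at the same point have product \<open>-1\<close>, so they coincide.
\<close>

section \<open>Quadruples of mutually tangent disks\<close>

type_synonym cvec = "real \<times> real \<times> complex"

text \<open>The polar form of \<open>b * c - z \<bullet> z\<close>. For round disks with radii r, r'
  and center distance d its value is \<open>(d^2 - r^2 - r'^2) / (2 r r')\<close>: 1 for external
  and -1 for internal tangency.\<close>

definition lorentz :: "cvec \<Rightarrow> cvec \<Rightarrow> real" where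
  "lorentz v w = (fst v * fst (snd w) + fst w * fst (snd v)) / 2 - snd (snd v) \<bullet> snd (snd w)"

lemma lorentz_add_left: "lorentz (u + v) w = lorentz u w + lorentz v w"
  and lorentz_diff_left: "lorentz (u - v) w = lorentz u w - lorentz v w"
  and lorentz_scaleR_left: "lorentz (a *\<^sub>R u) w = a * lorentz u w"
  by (simp_all add: lorentz_def inner_simps field_simps)

lemma lorentz_commute: "lorentz v w = lorentz w v"
  by (simp add: lorentz_def inner_commute)

lemma lorentz_sum_left: "lorentz (sum f A) w = (\<Sum>i\<in>A. lorentz (f i) w)"
proof (cases "finite A")
  case True
  then show ?thesis
    by (induction A rule: finite_induct) (auto simp: lorentz_add_left, simp add: lorentz_def)
qed (simp add: lorentz_def)

text \<open>
  The new entry is twice the sum of the other three minus the old one: in a fixed coordinate, the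
  two values completing three given ones are the roots of Descartes' quadratic equation.
\<close>

definition reflect :: "4 \<Rightarrow> (4 \<Rightarrow> 'a::real_vector) \<Rightarrow> 4 \<Rightarrow> 'a" where
  "reflect k f = f(k := 2 *\<^sub>R sum f UNIV - 3 *\<^sub>R f k)"

lemma reflect_other: "j \<noteq> k \<Longrightarrow> reflect k f j = f j"
  by (simp add: reflect_def)

lemma sum_reflect: "sum (reflect k f) UNIV = 3 *\<^sub>R sum f UNIV - 4 *\<^sub>R f k"
proof -
  have "sum (reflect k f) UNIV = (\<Sum>j\<in>UNIV. f j + (if j = k then 2 *\<^sub>R sum f UNIV - 4 *\<^sub>R f k else 0))"
    \<comment> \<open>The instance collects \<open>f k + 3 *\<^sub>R f k\<close> into
      \<open>4 *\<^sub>R f k\<close>.\<close>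
    using scaleR_left.add[of 1 3 "f k"] by (intro sum.cong) (auto simp: reflect_def)
  also have "\<dots> = sum f UNIV + (2 *\<^sub>R sum f UNIV - 4 *\<^sub>R f k)"
    by (simp add: sum.distrib)
  also have "\<dots> = 3 *\<^sub>R sum f UNIV - 4 *\<^sub>R f k"
    using scaleR_left.add[of 1 2 "sum f UNIV"] by simp
  finally show ?thesis .
qed

lemma reflect_reflect [simp]: "reflect k (reflect k f) = f"
proof
  fix j
  have "2 *\<^sub>R sum (reflect k f) UNIV - 3 *\<^sub>R reflect k f k = f k"
    using scaleR_left.add[of 1 8 "f k"] unfolding sum_reflect
    by (simp add: reflect_def scaleR_right_diff_distrib)
  then show "reflect k (reflect k f) j = f j"
    by (cases "j = k") (simp_all add: reflect_def)
qed

text \<open>Pairing with a fixed \<open>w\<close> is linear. This lets words of reflections be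
  followed on quadruples of reals.\<close>

lemma lorentz_reflect:
  "(\<lambda>j. lorentz (reflect k f j) w) = reflect k (\<lambda>j. lorentz (f j) w)"
  by (rule ext) (simp add: reflect_def lorentz_diff_left lorentz_scaleR_left lorentz_sum_left)

text \<open>The exterior disk, the two disks of radius 1/2 and the disk of curvature 3 with center
  (0, 2/3).\<close>

definition window_frame :: "4 \<Rightarrow> cvec" where
  "window_frame = (\<lambda>i. if i = 1 then (-1, 1, 0) else if i = 2 then (2, 0, 1)
     else if i = 3 then (2, 0, -1) else (3, 1, Complex 0 2))"

section \<open>The orbit of the initial quadruple and its invariants\<close>

definition reflection_step :: "((4 \<Rightarrow> cvec) \<times> (4 \<Rightarrow> cvec)) set" where
  "reflection_step = {(f, reflect k f) | f k. True}"

definition frames :: "(4 \<Rightarrow> cvec) set" where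
  "frames = {f. (window_frame, f) \<in> reflection_step\<^sup>*}"

lemma reflect_frames: "f \<in> frames \<Longrightarrow> reflect k f \<in> frames"
  by (auto simp: frames_def reflection_step_def intro: rtrancl_into_rtrancl)

lemma frames_induct [consumes 1, case_names base reflect]:
  assumes "f \<in> frames" "P window_frame"
    and "\<And>f k. f \<in> frames \<Longrightarrow> P f \<Longrightarrow> P (reflect k f)"
  shows "P f"
proof -
  have "(window_frame, f) \<in> reflection_step\<^sup>*" using assms(1) by (simp add: frames_def)
  then have "f \<in> frames \<and> P f"
  proof (induction rule: rtrancl_induct)
    case base
    then show ?case using assms(2) by (simp add: frames_def)
  next
    case (step y z)
    then obtain k where "z = reflect k y" by (auto simp: reflection_step_def)
    then show ?case using assms(3)[of y k] reflect_frames[of y k] step.IH by simp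
  qed
  then show ?thesis by simp
qed

text \<open>Reflections are involutions, so one can walk back to \<open>window_frame\<close> and out
  again.\<close>

lemma frames_connected:
  assumes "f \<in> frames" "g \<in> frames"
  shows "(f, g) \<in> reflection_step\<^sup>*"
proof -
  have "(reflect k f, f) \<in> reflection_step" for k f
  proof -
    have "(reflect k f, reflect k (reflect k f)) \<in> reflection_step"
      unfolding reflection_step_def by blast
    then show ?thesis by simp
  qed
  then have "sym reflection_step"
    unfolding sym_def by (auto simp: reflection_step_def)
  then have "sym (reflection_step\<^sup>*)" by (rule sym_rtrancl)
  then have "(f, window_frame) \<in> reflection_step\<^sup>*"
    using assms(1) by (auto simp: frames_def dest: symD)
  then show ?thesis
    using assms(2) by (simp add: frames_def)
qed

lemma sum_only_one_differs:
  fixes p :: "4 \<Rightarrow> real"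
  assumes "\<And>j. j \<noteq> d \<Longrightarrow> p j = a"
  shows "sum p UNIV = 3 * a + p d"
proof -
  have "sum p UNIV = p d + sum p (UNIV - {d})" by (rule sum.remove) auto
  also have "sum p (UNIV - {d}) = (\<Sum>j\<in>UNIV - {d}. a)" using assms by (intro sum.cong) auto
  finally show ?thesis by simp
qed

text \<open>All rows of this matrix sum to 2, so the new entry, twice the total minus three times
  the old one, has product 4 - 3 = 1 with the kept entries and 20 - 21 = -1 with itself.\<close>

lemma frame_gram:
  assumes "f \<in> frames"
  shows "lorentz (f i) (f j) = (if i = j then -1 else 1)"
  using assms
proof (induction arbitrary: i j rule: frames_induct)
  case base
  have "\<forall>i j. lorentz (window_frame i) (window_frame j) = (if i = j then -1 else 1)"
    unfolding forall_4 by (simp add: window_frame_def lorentz_def inner_complex_def)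
  then show ?case by blast
next
  case (reflect f k)
  have S: "lorentz (sum f UNIV) (f j) = 2" for j
    using sum_only_one_differs[of j "\<lambda>i. lorentz (f i) (f j)" 1] reflect
    by (simp add: lorentz_sum_left)
  have S': "lorentz (f j) (sum f UNIV) = 2" for j using S lorentz_commute by simp
  have SS: "lorentz (sum f UNIV) (sum f UNIV) = 8"
    by (simp add: lorentz_sum_left S' )
  have new: "lorentz (reflect k f k) (f j) = 4 - 3 * lorentz (f k) (f j)" for j
    by (simp add: reflect_def lorentz_diff_left lorentz_scaleR_left S)
  have new': "lorentz (f j) (reflect k f k) = 4 - 3 * lorentz (f k) (f j)" for j
    using new lorentz_commute by simp
  have "lorentz (reflect k f k) (sum f UNIV) = 10"
    by (simp add: reflect_def lorentz_diff_left lorentz_scaleR_left S' SS)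
  then have "lorentz (sum f UNIV) (reflect k f k) = 10"
    by (simp only: lorentz_commute)
  then have kk: "lorentz (reflect k f k) (reflect k f k) = -1"
    using new'[of k] reflect.IH[of k k]
    by (subst (1) reflect_def) (simp add: lorentz_diff_left lorentz_scaleR_left)
  show ?case
    using reflect.IH new new' kk
    by (cases "i = k"; cases "j = k") (simp_all add: reflect_other)
qed

text \<open>A general Descartes theorem: for \<open>w = (0, 2, 0)\<close> the products are the
  curvatures and the right side vanishes. The old and the new product sum to twice the sum of the
  other three, and at two such values the quadratic polynomial in that product agrees.\<close>

lemma frame_quadratic_form:
  assumes "f \<in> frames"
  shows "(\<Sum>j\<in>UNIV. lorentz (f j) w)\<^sup>2 - 2 * (\<Sum>j\<in>UNIV. (lorentz (f j) w)\<^sup>2) = 4 * lorentz w w"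
  using assms
proof (induction rule: frames_induct)
  case base
  obtain b c z where w: "w = (b, c, z)" by (cases w) auto
  show ?case
    unfolding w sum_4 by (simp add: window_frame_def lorentz_def inner_complex_def power2_eq_square field_simps)
next
  case (reflect f k)
  define p where "p = (\<lambda>j. lorentz (f j) w)"
  have "(\<Sum>j\<in>UNIV. (reflect k p j)\<^sup>2) = (reflect k p k)\<^sup>2 + (\<Sum>j\<in>UNIV - {k}. (reflect k p j)\<^sup>2)"
    by (simp add: sum.remove[of UNIV k])
  also have "(\<Sum>j\<in>UNIV - {k}. (reflect k p j)\<^sup>2) = (\<Sum>j\<in>UNIV - {k}. (p j)\<^sup>2)"
    by (intro sum.cong) (auto simp: reflect_other)
  also have "\<dots> = (\<Sum>j\<in>UNIV. (p j)\<^sup>2) - (p k)\<^sup>2"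
    by (simp add: sum.remove[of UNIV k])
  finally have sq: "(\<Sum>j\<in>UNIV. (reflect k p j)\<^sup>2)
      = (2 * sum p UNIV - 3 * p k)\<^sup>2 + (\<Sum>j\<in>UNIV. (p j)\<^sup>2) - (p k)\<^sup>2"
    by (simp add: reflect_def)
  have "(sum (reflect k p) UNIV)\<^sup>2 - 2 * (\<Sum>j\<in>UNIV. (reflect k p j)\<^sup>2)
      = (sum p UNIV)\<^sup>2 - 2 * (\<Sum>j\<in>UNIV. (p j)\<^sup>2)"
    unfolding sq sum_reflect by (simp add: power2_eq_square algebra_simps)
  then show ?case
    using reflect.IH fun_cong[OF lorentz_reflect[of k f w]] by (simp add: p_def)
qed

text \<open>For the initial frame this is solving four linear equations. A reflection changes the
  four products invertibly, so the property passes to every frame.\<close>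

lemma frame_nondegenerate:
  assumes "f \<in> frames" "\<And>j. lorentz (f j) v = lorentz (f j) w"
  shows "v = w"
  using assms
proof (induction rule: frames_induct)
  case base
  obtain b c z where v: "v = (b, c, z)" by (cases v) auto
  obtain b' c' z' where w: "w = (b', c', z')" by (cases w) auto
  from base[of 1] base[of 2] base[of 3] base[of 4] show ?case
    unfolding v w by (simp add: window_frame_def lorentz_def inner_complex_def complex_eq_iff field_simps)
next
  case (reflect f k)
  have "(\<lambda>j. lorentz (reflect k f j) v) = (\<lambda>j. lorentz (reflect k f j) w)"
    using reflect.prems by auto
  then have "reflect k (reflect k (\<lambda>j. lorentz (f j) v)) = reflect k (reflect k (\<lambda>j. lorentz (f j) w))"
    unfolding lorentz_reflect by simp
  then show ?case using reflect.IH by (simp add: fun_eq_iff)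
qed

section \<open>Growth of products along reduced words\<close>

definition circle_vectors :: "cvec set" where
  "circle_vectors = {f i | f i. f \<in> frames}"

text \<open>The products of a frame with its own i-th member.\<close>

definition unit_products :: "4 \<Rightarrow> 4 \<Rightarrow> real" where
  "unit_products i = (\<lambda>j. if j = i then -1 else 1)"

text \<open>The index records the last reflection, so a word can only be continued in a reduced way.\<close>

inductive grown_products :: "4 \<Rightarrow> (4 \<Rightarrow> real) \<Rightarrow> bool" where
  start: "grown_products i (reflect i (unit_products i))"
| grow: "grown_products i p \<Longrightarrow> j \<noteq> i \<Longrightarrow> grown_products j (reflect j p)"

text \<open>The total is 2, so a reflected entry becomes 4 + 3 = 7 at i and stays 4 - 3 = 1
  elsewhere.\<close>

lemma reflect_unit_products:
  "reflect k (unit_products i) = (if k = i then (\<lambda>j. if j = i then 7 else 1) else unit_products i)"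
  using sum_only_one_differs[of i "unit_products i" 1]
  by (auto simp: reflect_def unit_products_def)

text \<open>By the second conjunct the entry reflected last is at least the sum of the other three.
  This invariant keeps the next reflected entry from dropping below 1.\<close>

lemma grown_products_bounds:
  assumes "grown_products i p"
  shows "(\<forall>j. p j \<ge> 1) \<and> 2 * p i \<ge> sum p UNIV"
  using assms
proof induction
  case (start i)
  then show ?case
    using sum_only_one_differs[of i "\<lambda>j. if j = i then 7 else 1" 1]
    by (simp add: reflect_unit_products)
next
  case (grow i p j)
  have pos: "p l \<ge> 1" for l using grow by simp
  \<comment> \<open>The two entries other than i and j contribute at least 1 each.\<close>
  have "sum p UNIV = p i + (p j + sum p (UNIV - {i} - {j}))"
    using grow(2) by (simp add: sum.remove[of UNIV i] sum.remove[of "UNIV - {i}" j])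
  moreover have "sum p (UNIV - {i} - {j}) \<ge> (\<Sum>l\<in>UNIV - {i} - {j}. 1)"
    using pos by (intro sum_mono)
  moreover have "(\<Sum>l\<in>UNIV - {i} - {j}. 1 :: real) = 2"
    using grow(2) by (simp add: card_Diff_subset)
  ultimately have s: "sum p UNIV \<ge> p i + p j + 2" and ij: "p i \<ge> p j + 2"
    using grow(3) by linarith+
  have "reflect j p j \<ge> 1"
    using s ij pos[of j] by (simp add: reflect_def)
  then have "reflect j p l \<ge> 1" for l
    using pos[of l] by (cases "l = j") (auto simp: reflect_other)
  \<comment> \<open>By \<open>sum_reflect\<close> this amounts to
    \<open>sum p UNIV \<ge> 2 * p j\<close>.\<close>
  moreover have "2 * reflect j p j \<ge> sum (reflect j p) UNIV"
    unfolding sum_reflect using s ij by (simp add: reflect_def)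
  ultimately show ?case by blast
qed

text \<open>The other three entries are at least 1, and the last reflected one dominates their sum.
  So an entry with value 1 was not the last to be reflected.\<close>

lemma grown_products_max:
  assumes "grown_products i p"
  shows "p i \<ge> 3"
proof -
  have "sum p (UNIV - {i}) \<ge> (\<Sum>l\<in>UNIV - {i}. 1)"
    using grown_products_bounds[OF assms] by (intro sum_mono) auto
  then have "sum p UNIV \<ge> p i + 3" by (simp add: sum.remove[of UNIV i])
  then show ?thesis using grown_products_bounds[OF assms] by linarith
qed

definition admissible_products :: "(4 \<Rightarrow> real) \<Rightarrow> bool" where
  "admissible_products p \<longleftrightarrow> (\<exists>i. p = unit_products i) \<or> (\<exists>i. grown_products i p)"

text \<open>A further reflection extends the reduced word or undoes its last letter; from
  \<open>unit_products i\<close> it starts a word or changes nothing.\<close>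

lemma admissible_products_reflect:
  assumes "admissible_products p"
  shows "admissible_products (reflect k p)"
  using assms unfolding admissible_products_def
proof (elim disjE exE)
  fix i assume "p = unit_products i"
  then show "(\<exists>i. reflect k p = unit_products i) \<or> (\<exists>i. grown_products i (reflect k p))"
    using start[of i] reflect_unit_products[of k i] by (cases "k = i") auto
next
  fix i assume p: "grown_products i p"
  show "(\<exists>i. reflect k p = unit_products i) \<or> (\<exists>i. grown_products i (reflect k p))"
  proof (cases "k = i")
    case True
    from p show ?thesis unfolding True by cases (auto)
  qed (use p grow in blast)
qed

text \<open>Walk to \<open>f\<close> from a frame containing \<open>v\<close>, where the products
  are \<open>unit_products\<close>.\<close>

lemma admissible_frame_products:
  assumes "f \<in> frames" "v \<in> circle_vectors"
  shows "admissible_products (\<lambda>j. lorentz (f j) v)"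
proof -
  obtain g i where g: "g \<in> frames" "v = g i" using assms(2) by (auto simp: circle_vectors_def)
  show ?thesis using frames_connected[OF g(1) assms(1)]
  proof (induction rule: rtrancl_induct)
    case base
    have "(\<lambda>j. lorentz (g j) v) = unit_products i"
      using frame_gram[OF g(1)] g(2) by (auto simp: unit_products_def)
    then show ?case by (auto simp: admissible_products_def)
  next
    case (step y z)
    then obtain k where "z = reflect k y" by (auto simp: reflection_step_def)
    then show ?case
      using admissible_products_reflect[OF step.IH, of k] by (simp add: lorentz_reflect)
  qed
qed

lemma unit_products_imp_member:
  assumes "f \<in> frames" "(\<lambda>j. lorentz (f j) v) = unit_products i"
  shows "v = f i"
proof (rule frame_nondegenerate[OF assms(1)])
  show "lorentz (f j) v = lorentz (f j) (f i)" for j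
    using frame_gram[OF assms(1), of j i] fun_cong[OF assms(2), of j] by (simp add: unit_products_def)
qed

text \<open>Read \<open>w\<close> against a frame with \<open>v\<close> in position i: the only
  entry below 1 in admissible products is the -1 of a member. Later this identifies two orbit
  vectors whose product is below 1.\<close>

lemma circle_vectors_disjoint:
  assumes "v \<in> circle_vectors" "w \<in> circle_vectors" "v \<noteq> w"
  shows "lorentz v w \<ge> 1"
proof -
  obtain f i where f: "f \<in> frames" "v = f i" using assms(1) by (auto simp: circle_vectors_def)
  from admissible_frame_products[OF f(1) assms(2)] show ?thesis
    unfolding admissible_products_def
  proof (elim disjE exE)
    fix m assume m: "(\<lambda>j. lorentz (f j) w) = unit_products m"
    then have "m \<noteq> i" using unit_products_imp_member[OF f(1)] f(2) assms(3) by metis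
    then show ?thesis using fun_cong[OF m, of i] f(2) by (simp add: unit_products_def)
  next
    fix m assume "grown_products m (\<lambda>j. lorentz (f j) w)"
    then show ?thesis using grown_products_bounds f(2) by blast
  qed
qed

text \<open>Descent: undo the last reflection until \<open>v\<close> becomes a member. The index
  being reflected has product at least 3, so members with product 1 are never exchanged.\<close>

lemma frame_through_tangent_vectors:
  assumes "f \<in> frames" "v \<in> circle_vectors"
  shows "\<exists>g\<in>frames. (\<forall>a. lorentz (f a) v = 1 \<longrightarrow> g a = f a) \<and> (\<exists>m. v = g m)"
proof -
  have grown: "\<exists>g\<in>frames. (\<forall>a. lorentz (f a) v = 1 \<longrightarrow> g a = f a) \<and> (\<exists>m. v = g m)"
    if "grown_products i p" "f \<in> frames" "(\<lambda>j. lorentz (f j) v) = p" for i p f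
    using that
  proof (induction arbitrary: f)
    case (start i)
    have "(\<lambda>j. lorentz (reflect i f j) v) = unit_products i"
      by (simp add: lorentz_reflect start)
    then have "v = reflect i f i"
      using unit_products_imp_member reflect_frames start by blast
    moreover have "lorentz (f i) v = 7"
      using fun_cong[OF start(2), of i] by (simp add: reflect_unit_products)
    ultimately show ?case
      using reflect_frames[OF start(1), of i] by (intro bexI[of _ "reflect i f"]) (auto simp: reflect_def)
  next
    case (grow i p j)
    have "(\<lambda>l. lorentz (reflect j f l) v) = p"
      by (simp add: lorentz_reflect grow)
    then obtain g where g: "g \<in> frames" "\<forall>a. lorentz (reflect j f a) v = 1 \<longrightarrow> g a = reflect j f a"
        "\<exists>m. v = g m"
      using grow.IH reflect_frames[OF grow.prems(1)] by blast
    have "reflect j p j \<ge> 3"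
      using grown_products_max[OF grown_products.grow[OF grow.hyps]] .
    then have "lorentz (f j) v \<ge> 3" using fun_cong[OF grow.prems(2), of j] by simp
    then have "g a = f a" if "lorentz (f a) v = 1" for a
      using g(2) that by (cases "a = j") (auto simp: reflect_other)
    then show ?case using g by blast
  qed
  from admissible_frame_products[OF assms] show ?thesis
    unfolding admissible_products_def
  proof (elim disjE exE)
    fix i assume "(\<lambda>j. lorentz (f j) v) = unit_products i"
    then show ?thesis using unit_products_imp_member[OF assms(1)] assms(1) by blast
  qed (use grown assms(1) in blast)
qed

text \<open>Put the three vectors into one frame. The quadratic form then leaves two values for the
  remaining product of \<open>w\<close>: -1 for the fourth member and 7 for its reflection.\<close>

lemma circle_vectors_closed:
  assumes T: "v1 \<in> circle_vectors" "v2 \<in> circle_vectors" "v3 \<in> circle_vectors"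
    and tan: "lorentz v1 v2 = 1" "lorentz v2 v3 = 1" "lorentz v1 v3 = 1"
    and w: "lorentz w w = -1" "lorentz w v1 = 1" "lorentz w v2 = 1" "lorentz w v3 = 1"
  shows "w \<in> circle_vectors"
proof -
  obtain f i where f: "f \<in> frames" "v1 = f i" using T(1) by (auto simp: circle_vectors_def)
  obtain g m where g: "g \<in> frames" "v1 = g i" "v2 = g m"
    using frame_through_tangent_vectors[OF f(1) T(2)] f(2) tan by metis
  \<comment> \<open>The second descent keeps both \<open>v1\<close> and \<open>v2\<close>, as each
    has product 1 with \<open>v3\<close>.\<close>
  obtain h l where h: "h \<in> frames" "v1 = h i" "v2 = h m" "v3 = h l"
    using frame_through_tangent_vectors[OF g(1) T(3)] g tan by metis
  have neq: "i \<noteq> m" "m \<noteq> l" "i \<noteq> l"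
    using tan h frame_gram[OF h(1)] by auto
  then have "card (UNIV - {i, m, l}) = 1" by (simp add: card_Diff_subset)
  then obtain d where d: "UNIV - {i, m, l} = {d}" by (auto simp: card_1_singleton_iff)
  define p where "p = (\<lambda>j. lorentz (h j) w)"
  have p1: "p j = 1" if "j \<noteq> d" for j
    using d that w(2-) h lorentz_commute[of w] unfolding p_def by (metis DiffI UNIV_I empty_iff insertE)
  have "sum p UNIV = 3 + p d" "(\<Sum>j\<in>UNIV. (p j)\<^sup>2) = 3 + (p d)\<^sup>2"
    using sum_only_one_differs[of d p 1] sum_only_one_differs[of d "\<lambda>j. (p j)\<^sup>2" 1] p1 by auto
  then have "(3 + p d)\<^sup>2 - 2 * (3 + (p d)\<^sup>2) = -4"
    using frame_quadratic_form[OF h(1), of w] w(1) by (simp add: p_def)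
  then have "(p d + 1) * (p d - 7) = 0" by (simp add: power2_eq_square algebra_simps)
  then consider "p d = -1" | "p d = 7" by auto
  then show ?thesis
  proof cases
    case 1
    then have "p = unit_products d" using p1 by (auto simp: unit_products_def)
    then have "w = h d" using unit_products_imp_member[OF h(1)] by (simp add: p_def)
    then show ?thesis using h(1) by (auto simp: circle_vectors_def)
  next
    case 2
    then have "p = reflect d (unit_products d)" using p1 by (auto simp: reflect_unit_products)
    then have "(\<lambda>j. lorentz (reflect d h j) w) = unit_products d"
      by (simp add: lorentz_reflect p_def)
    then have "w = reflect d h d" using unit_products_imp_member reflect_frames[OF h(1)] by blast
    then show ?thesis using reflect_frames[OF h(1)] by (auto simp: circle_vectors_def)
  qed
qed

text \<open>Reflections have integer coefficients and the initial vectors are integral.\<close>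

lemma circle_vectors_integral:
  assumes "v \<in> circle_vectors"
  shows "fst v \<in> \<int> \<and> Re (snd (snd v)) \<in> \<int> \<and> Im (snd (snd v)) \<in> \<int>"
proof -
  have "\<forall>i. fst (f i) \<in> \<int> \<and> Re (snd (snd (f i))) \<in> \<int> \<and> Im (snd (snd (f i))) \<in> \<int>"
    if "f \<in> frames" for f
    using that
  proof (induction rule: frames_induct)
    case base
    show ?case by (auto simp: window_frame_def)
  next
    case (reflect f k)
    then show ?case
      by (auto simp: reflect_def fst_sum snd_sum Re_sum Im_sum intro!: Ints_diff Ints_mult Ints_sum)
  qed
  then show ?thesis using assms by (auto simp: circle_vectors_def)
qed

section \<open>Disks and their vectors\<close>

text \<open>For norm -1 and \<open>b \<noteq> 0\<close> this is
  \<open>b * |w - z/b|^2 - 1/b\<close>. The sign of \<open>b\<close> separates balls from exteriors,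
  and \<open>b = 0\<close> gives half-planes.\<close>

fun disk_form :: "cvec \<Rightarrow> complex \<Rightarrow> real" where
  "disk_form (b, c, z) w = b * (w \<bullet> w) - 2 * (z \<bullet> w) + c"

definition disk_of :: "cvec \<Rightarrow> complex set" where
  "disk_of v = {w. disk_form v w \<le> 0}"

lemma disk_form_cball:
  shows "disk_form (1 / r, ((norm c)\<^sup>2 - r\<^sup>2) / r, c /\<^sub>R r) w = ((dist c w)\<^sup>2 - r\<^sup>2) / r"
proof -
  have d: "(dist c w)\<^sup>2 = (norm c)\<^sup>2 - 2 * (c \<bullet> w) + w \<bullet> w"
    by (simp add: dist_norm power2_norm_eq_inner inner_diff_left inner_diff_right inner_commute)
  show ?thesis unfolding d by (simp add: divide_inverse algebra_simps)
qed

lemma disk_of_cball: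
  assumes "r > 0"
  shows "disk_of (1 / r, ((norm c)\<^sup>2 - r\<^sup>2) / r, c /\<^sub>R r) = cball c r"
proof -
  have le: "(x\<^sup>2 - r\<^sup>2) / r \<le> 0 \<longleftrightarrow> x \<le> r" if "x \<ge> 0" for x
    using assms that by (simp add: divide_le_0_iff power2_le_iff_abs_le)
  show ?thesis
    unfolding disk_of_def disk_form_cball le[OF zero_le_dist] cball_def ..
qed

lemma disk_of_exterior:
  assumes "r > 0"
  shows "disk_of (- 1 / r, - (((norm c)\<^sup>2 - r\<^sup>2) / r), - (c /\<^sub>R r)) = - ball c r"
proof -
  have neg: "disk_form (- 1 / r, - (((norm c)\<^sup>2 - r\<^sup>2) / r), - (c /\<^sub>R r)) w = - (((dist c w)\<^sup>2 - r\<^sup>2) / r)" for w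
    using disk_form_cball[of r c w] by simp
  have le: "- ((x\<^sup>2 - r\<^sup>2) / r) \<le> 0 \<longleftrightarrow> r \<le> x" if "x \<ge> 0" for x
    using assms that by (simp add: zero_le_divide_iff power_mono_iff)
  have "disk_of (- 1 / r, - (((norm c)\<^sup>2 - r\<^sup>2) / r), - (c /\<^sub>R r)) = {w. r \<le> dist c w}"
    unfolding disk_of_def neg le[OF zero_le_dist] ..
  also have "\<dots> = - ball c r" by auto
  finally show ?thesis .
qed

lemma lorentz_self: "lorentz (b, c, z) (b, c, z) = b * c - z \<bullet> z"
  by (simp add: lorentz_def)

lemma inner_scaleR_divide: "(z /\<^sub>R r) \<bullet> (z /\<^sub>R r) = z \<bullet> z / r / r"
  by (simp add: divide_inverse_commute)

lemma disk_imp_disk_of: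
  assumes "disk D"
  obtains v where "lorentz v v = -1" "D = disk_of v"
proof -
  from assms consider
      c r where "r > 0" "D = cball c r"
    | c r where "r > 0" "D = - ball c r"
    | a b where "a \<noteq> 0" "D = {z. a \<bullet> z \<le> b}"
    unfolding disk_def half_plane_def by blast
  then show ?thesis
  proof cases
    case 1
    have "1 / r * ((x - r\<^sup>2) / r) - x / r / r = -1" for x :: real
      using 1(1) by (simp add: field_simps power2_eq_square)
    from this[of "c \<bullet> c"] have "lorentz (1 / r, ((norm c)\<^sup>2 - r\<^sup>2) / r, c /\<^sub>R r) (1 / r, ((norm c)\<^sup>2 - r\<^sup>2) / r, c /\<^sub>R r) = -1"
      unfolding lorentz_self inner_minus_left inner_minus_right inner_scaleR_divide power2_norm_eq_inner .
    then show ?thesis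
      by (rule that) (simp only: disk_of_cball[OF 1(1), of c] 1(2))
  next
    case 2
    have "1 / r * ((x - r\<^sup>2) / r) - x / r / r = -1" for x :: real
      using 2(1) by (simp add: field_simps power2_eq_square)
    from this[of "c \<bullet> c"] have "lorentz (- 1 / r, - (((norm c)\<^sup>2 - r\<^sup>2) / r), - (c /\<^sub>R r))
       (- 1 / r, - (((norm c)\<^sup>2 - r\<^sup>2) / r), - (c /\<^sub>R r)) = -1"
      unfolding lorentz_self inner_minus_left inner_minus_right inner_scaleR_divide power2_norm_eq_inner
      by simp
    then show ?thesis
      by (rule that) (simp only: disk_of_exterior[OF 2(1), of c] 2(2))
  next
    case 3
    \<comment> \<open>The last entry is the inward unit normal; the middle one fits the form to the
      boundary line.\<close>
    let ?v = "(0, - 2 * b / norm a, - (a /\<^sub>R norm a))"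
    have "lorentz ?v ?v = -1"
      using 3(1) by (simp add: lorentz_def dot_square_norm power2_eq_square)
    then show ?thesis
    proof (rule that)
      have "disk_form ?v w = 2 * (a \<bullet> w - b) / norm a" for w
        by (simp add: divide_inverse algebra_simps)
      then show "D = disk_of ?v"
        unfolding disk_of_def 3(2) using 3(1) by (simp add: divide_le_0_iff del: disk_form.simps)
    qed
  qed
qed

lemma continuous_disk_form: "continuous_on UNIV (disk_form v)"
  by (cases v) (simp add: continuous_intros)

lemma disk_form_less_interior: "{w. disk_form v w < 0} \<subseteq> interior (disk_of v)"
proof (rule interior_maximal)
  show "open {w. disk_form v w < 0}"
    using continuous_disk_form by (intro open_Collect_less) (auto intro: continuous_intros)
qed (auto simp: disk_of_def)

lemma frontier_disk_of: "frontier (disk_of v) \<subseteq> {w. disk_form v w = 0}"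
proof -
  have "closed (disk_of v)"
    unfolding disk_of_def
    using continuous_disk_form by (intro closed_Collect_le) (auto intro: continuous_intros)
  then have "frontier (disk_of v) = disk_of v - interior (disk_of v)"
    by (simp add: frontier_def)
  then have "frontier (disk_of v) \<subseteq> disk_of v - {w. disk_form v w < 0}"
    using disk_form_less_interior[of v] by blast
  then show ?thesis by (auto simp: disk_of_def)
qed

section \<open>Tangency read as product 1\<close>

lemma eventually_quadratic_neg:
  fixes a b :: real
  assumes "a < 0"
  shows "\<forall>\<^sub>F e in at_right 0. e * a + e\<^sup>2 * b < 0"
proof -
  have "((\<lambda>e. a + e * b) \<longlongrightarrow> a + 0 * b) (at_right 0)" by (intro tendsto_intros)
  then have "\<forall>\<^sub>F e in at_right 0. a + e * b < 0"
    using assms by (auto dest: order_tendstoD(2)[where a = 0])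
  moreover have "\<forall>\<^sub>F e in at_right (0::real). e > 0" by (rule eventually_at_right_less)
  ultimately show ?thesis
  proof eventually_elim
    case (elim e)
    have "e * a + e\<^sup>2 * b = e * (a + e * b)" by (simp add: power2_eq_square algebra_simps)
    with elim show ?case by (simp add: mult_pos_neg)
  qed
qed

text \<open>Unless the outward normals at \<open>p\<close> are opposite, moving from
  \<open>p\<close> against their sum enters both interiors. Opposite normals mean product 1.\<close>

lemma lorentz_common_boundary_point:
  assumes v: "lorentz v v = -1" and w: "lorentz w w = -1"
    and p: "disk_form v p = 0" "disk_form w p = 0"
    and disj: "interior (disk_of v) \<inter> interior (disk_of w) = {}"
  shows "lorentz v w = 1"
proof -
  obtain b c z where v': "v = (b, c, z)" by (cases v) auto
  obtain b' c' z' where w': "w = (b', c', z')" by (cases w) auto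
  \<comment> \<open>the outward unit normals of the two disks at \<open>p\<close>; their inner product is \<open>- lorentz v w\<close>\<close>
  define g where "g = b *\<^sub>R p - z"
  define g' where "g' = b' *\<^sub>R p - z'"
  have zp: "2 * (z \<bullet> p) = b * (p \<bullet> p) + c" "2 * (z' \<bullet> p) = b' * (p \<bullet> p) + c'"
    using p by (auto simp: v' w')
  have gg: "g \<bullet> g = b * (b * (p \<bullet> p)) - b * (2 * (z \<bullet> p)) + z \<bullet> z"
    "g' \<bullet> g' = b' * (b' * (p \<bullet> p)) - b' * (2 * (z' \<bullet> p)) + z' \<bullet> z'"
    by (simp_all add: g_def g'_def inner_simps inner_commute algebra_simps)
  have n: "g \<bullet> g = 1" "g' \<bullet> g' = 1"
    using v w unfolding gg zp by (simp_all add: v' w' lorentz_def algebra_simps)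
  have "2 * (g \<bullet> g') = 2 * b * b' * (p \<bullet> p) - b * (2 * (z' \<bullet> p)) - b' * (2 * (z \<bullet> p)) + 2 * (z \<bullet> z')"
    by (simp add: g_def g'_def inner_simps inner_commute algebra_simps)
  then have gl: "lorentz v w = - (g \<bullet> g')"
    unfolding zp by (simp add: v' w' lorentz_def field_simps)
  \<comment> \<open>Exact expansion at \<open>p\<close>: the constant term vanishes on the boundary
    and the gradient is twice the normal.\<close>
  have move: "disk_form v (p - e *\<^sub>R d) = e * (- 2 * (g \<bullet> d)) + e\<^sup>2 * (b * (d \<bullet> d))"
    "disk_form w (p - e *\<^sub>R d) = e * (- 2 * (g' \<bullet> d)) + e\<^sup>2 * (b' * (d \<bullet> d))" for e d
    using p by (simp_all add: v' w' g_def g'_def inner_simps inner_commute algebra_simps power2_eq_square)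
  show ?thesis
  proof (rule ccontr)
    assume "lorentz v w \<noteq> 1"
    moreover have "\<bar>g \<bullet> g'\<bar> \<le> 1"
      using Cauchy_Schwarz_ineq2[of g g'] n by (simp add: norm_eq_sqrt_inner)
    ultimately have pos: "1 + g \<bullet> g' > 0" using gl by linarith
    have "\<forall>\<^sub>F e in at_right 0. e * (- 2 * (1 + g \<bullet> g')) + e\<^sup>2 * (b * ((g + g') \<bullet> (g + g'))) < 0"
      "\<forall>\<^sub>F e in at_right 0. e * (- 2 * (1 + g \<bullet> g')) + e\<^sup>2 * (b' * ((g + g') \<bullet> (g + g'))) < 0"
      using pos by (intro eventually_quadratic_neg; simp)+
    then have "\<forall>\<^sub>F e in at_right (0::real). disk_form v (p - e *\<^sub>R (g + g')) < 0 \<and> disk_form w (p - e *\<^sub>R (g + g')) < 0"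
    proof eventually_elim
      case (elim e)
      moreover have "g \<bullet> (g + g') = 1 + g \<bullet> g'" "g' \<bullet> (g + g') = 1 + g \<bullet> g'"
        using n by (simp_all add: inner_simps inner_commute)
      ultimately show ?case unfolding move by simp
    qed
    then obtain e where "disk_form v (p - e *\<^sub>R (g + g')) < 0" "disk_form w (p - e *\<^sub>R (g + g')) < 0"
      using eventually_happens'[OF trivial_limit_at_right_real] by blast
    then show False
      using disj disk_form_less_interior[of v] disk_form_less_interior[of w] by blast
  qed
qed

text \<open>On the line spanned by the normal \<open>a\<close> the form is a polynomial with
  quadratic coefficient \<open>b * (a \<bullet> a)\<close>. For \<open>b \<noteq> 0\<close> it has
  the same sign at both ends, whereas a half-plane contains only one of them.\<close>

lemma half_plane_curvature:
  assumes "half_plane (disk_of (b, c, z))"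
  shows "b = 0"
proof (rule ccontr)
  obtain a d where a: "a \<noteq> 0" "disk_of (b, c, z) = {w. a \<bullet> w \<le> d}"
    using assms unfolding half_plane_def by blast
  have aa: "a \<bullet> a > 0" using a by simp
  assume "b \<noteq> 0"
  have linear: "\<forall>\<^sub>F s in at_top. k < s * \<beta>" if "\<beta> > 0" for k \<beta> :: real
    using eventually_gt_at_top[of "k / \<beta>"] by eventually_elim (use that in \<open>simp add: field_simps\<close>)
  have big: "\<forall>\<^sub>F s in at_top. k < s * (a \<bullet> a)" for k
    using linear[OF aa] .
  have form: "disk_form (b, c, z) (s *\<^sub>R a) = s * (s * (b * (a \<bullet> a)) - 2 * (z \<bullet> a)) + c" for s
    by (simp add: inner_simps algebra_simps)
  have growth: "\<forall>\<^sub>F s::real in at_top. s * (s * \<beta> - \<gamma>) + \<delta> > 0" if "\<beta> > 0" for \<beta> \<gamma> \<delta> :: real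
    using linear[OF that, of "\<bar>\<gamma>\<bar> + \<bar>\<delta>\<bar>"] eventually_ge_at_top[of 1]
  proof eventually_elim
    case (elim s)
    have "s * \<beta> - \<gamma> \<le> s * (s * \<beta> - \<gamma>)"
      using mult_right_mono[of 1 s "s * \<beta> - \<gamma>"] elim by auto
    then show ?case using elim by linarith
  qed
  show False
  proof (cases "b > 0")
    case True
    then have "\<forall>\<^sub>F s in at_top. s * (s * (b * (a \<bullet> a)) - (- 2 * (z \<bullet> a))) + c > 0"
      using aa by (intro growth) simp
    with big[of "- d"] have "\<forall>\<^sub>F s::real in at_top. False"
    proof eventually_elim
      case (elim s)
      then have "(- s) *\<^sub>R a \<in> disk_of (b, c, z)" unfolding a by simp
      then show ?case using elim form[of "-s"] unfolding disk_of_def by (simp add: algebra_simps)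
    qed
    then show False by simp
  next
    case False
    then have "\<forall>\<^sub>F s in at_top. s * (s * (- b * (a \<bullet> a)) - (- 2 * (z \<bullet> a))) + (- c) > 0"
      using aa \<open>b \<noteq> 0\<close> by (intro growth) (simp add: mult_neg_pos)
    with big[of d] have "\<forall>\<^sub>F s::real in at_top. False"
    proof eventually_elim
      case (elim s)
      then have "s *\<^sub>R a \<notin> disk_of (b, c, z)" unfolding a by simp
      then show ?case using elim form[of s] unfolding disk_of_def by (simp add: algebra_simps)
    qed
    then show False by simp
  qed
qed

text \<open>The argument with normals at infinity: unless the inward normals \<open>z\<close> and
  \<open>z'\<close> are opposite, points far out in direction \<open>z + z'\<close> lie in both
  interiors.\<close>

lemma lorentz_half_planes:
  assumes v: "lorentz v v = -1" and w: "lorentz w w = -1"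
    and "half_plane (disk_of v)" "half_plane (disk_of w)"
    and disj: "interior (disk_of v) \<inter> interior (disk_of w) = {}"
  shows "lorentz v w = 1"
proof -
  obtain c z where v': "v = (0, c, z)" using half_plane_curvature assms(3) by (cases v) auto
  obtain c' z' where w': "w = (0, c', z')" using half_plane_curvature assms(4) by (cases w) auto
  have n: "z \<bullet> z = 1" "z' \<bullet> z' = 1" using v w by (simp_all add: v' w' lorentz_def)
  show ?thesis
  proof (rule ccontr)
    assume "lorentz v w \<noteq> 1"
    moreover have "\<bar>z \<bullet> z'\<bar> \<le> 1"
      using Cauchy_Schwarz_ineq2[of z z'] n by (simp add: norm_eq_sqrt_inner)
    ultimately have pos: "1 + z \<bullet> z' > 0" by (simp add: v' w' lorentz_def)
    \<comment> \<open>So large that the linear terms outweigh both constants \<open>c\<close> and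
      \<open>c'\<close>.\<close>
    define s where "s = (\<bar>c\<bar> + \<bar>c'\<bar> + 1) / (1 + z \<bullet> z')"
    have s: "s * (1 + z \<bullet> z') = \<bar>c\<bar> + \<bar>c'\<bar> + 1" using pos by (simp add: s_def)
    have "z \<bullet> (s *\<^sub>R (z + z')) = s * (1 + z \<bullet> z')" "z' \<bullet> (s *\<^sub>R (z + z')) = s * (1 + z \<bullet> z')"
      using n by (simp_all add: inner_simps inner_commute)
    then have "disk_form v (s *\<^sub>R (z + z')) < 0" "disk_form w (s *\<^sub>R (z + z')) < 0"
      unfolding v' w' disk_form.simps s by auto
    then show False
      using disj disk_form_less_interior[of v] disk_form_less_interior[of w] by blast
  qed
qed

lemma tangent_imp_lorentz:
  assumes "lorentz v v = -1" "lorentz w w = -1" "tangent (disk_of v) (disk_of w)"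
  shows "lorentz v w = 1"
proof -
  have disj: "interior (disk_of v) \<inter> interior (disk_of w) = {}"
    using assms(3) by (simp add: tangent_def)
  from assms(3) consider p where "frontier (disk_of v) \<inter> frontier (disk_of w) = {p}"
    | "half_plane (disk_of v)" "half_plane (disk_of w)"
    unfolding tangent_def by blast
  then show ?thesis
  proof cases
    case 1
    then have "disk_form v p = 0" "disk_form w p = 0" using frontier_disk_of by blast+
    then show ?thesis by (rule lorentz_common_boundary_point[OF assms(1,2) _ _ disj])
  next
    case 2
    then show ?thesis by (rule lorentz_half_planes[OF assms(1,2) _ _ disj])
  qed
qed

section \<open>The packing lies in the orbit\<close>

lemma circle_vectors_normalized: "v \<in> circle_vectors \<Longrightarrow> lorentz v v = -1"
  using frame_gram by (auto simp: circle_vectors_def)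

lemma window_frame_in_circle_vectors: "window_frame i \<in> circle_vectors"
  by (auto simp: circle_vectors_def frames_def)

lemma exterior_vector: "(-1, 1, 0) \<in> circle_vectors"
  and right_vector: "(2, 0, 1) \<in> circle_vectors"
  and left_vector: "(2, 0, -1) \<in> circle_vectors"
  using window_frame_in_circle_vectors[of 1] window_frame_in_circle_vectors[of 2]
    window_frame_in_circle_vectors[of 3] by (simp_all add: window_frame_def)

lemma disk_of_exterior_vector: "disk_of (-1, 1, 0) = exterior_disk"
  using disk_of_exterior[of 1 0] by (simp add: exterior_disk_def)

text \<open>Tangency becomes product 1, so by \<open>circle_vectors_closed\<close> an adjoined disk
  cannot leave the orbit.\<close>

lemma apollonian_window_subset: "apollonian_window \<subseteq> disk_of ` circle_vectors"
proof
  fix D assume "D \<in> apollonian_window"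
  then show "D \<in> disk_of ` circle_vectors"
    unfolding apollonian_window_def
  proof induction
    case (seed D)
    have "disk_of (2, 0, 1) = cball (Complex (1/2) 0) (1/2)"
      "disk_of (2, 0, -1) = cball (Complex (-1/2) 0) (1/2)"
      using disk_of_cball[of "1/2" "Complex (1/2) 0"] disk_of_cball[of "1/2" "Complex (-1/2) 0"]
      by (simp_all add: cmod_def scaleR_complex.ctr one_complex.ctr uminus_complex.ctr)
    then show ?case
      using seed disk_of_exterior_vector exterior_vector right_vector left_vector by auto
  next
    case (adjoin D1 D2 D3 D)
    from adjoin.IH obtain v1 v2 v3
      where v: "v1 \<in> circle_vectors" "v2 \<in> circle_vectors" "v3 \<in> circle_vectors"
        and D: "D1 = disk_of v1" "D2 = disk_of v2" "D3 = disk_of v3"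
      by (elim imageE)
    obtain w where w: "lorentz w w = -1" "D = disk_of w"
      using disk_imp_disk_of[OF adjoin.hyps(7)] .
    note n = v[THEN circle_vectors_normalized]
    have "lorentz v1 v2 = 1" "lorentz v2 v3 = 1" "lorentz v1 v3 = 1"
      "lorentz w v1 = 1" "lorentz w v2 = 1" "lorentz w v3 = 1"
      using adjoin.hyps(4-6,8-10) unfolding D w(2)
      by (simp_all only: tangent_imp_lorentz[OF n(1) n(2)] tangent_imp_lorentz[OF n(2) n(3)]
          tangent_imp_lorentz[OF n(1) n(3)] tangent_imp_lorentz[OF w(1) n(1)]
          tangent_imp_lorentz[OF w(1) n(2)] tangent_imp_lorentz[OF w(1) n(3)])
    then have "w \<in> circle_vectors"
      using circle_vectors_closed[OF v] w(1) by simp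
    then show ?case using w by blast
  qed
qed

section \<open>Disks with coprime parameters\<close>

lemma tangent_cballs:
  fixes c c' :: complex
  assumes "r > 0" "r' > 0" and d: "dist c c' = r + r'"
  shows "tangent (cball c r) (cball c' r')"
proof -
  \<comment> \<open>The point dividing the segment between the centers in the ratio
    \<open>r : r'\<close>.\<close>
  let ?p = "c + (r / (r + r')) *\<^sub>R (c' - c)"
  have pos: "r + r' > 0" using assms by simp
  have pc: "c - ?p = (r / (r + r')) *\<^sub>R (c - c')" by (simp add: algebra_simps)
  have "1 - r / (r + r') = r' / (r + r')" using pos by (simp add: field_simps)
  moreover have "c' - ?p = (1 - r / (r + r')) *\<^sub>R (c' - c)" by (simp add: algebra_simps)
  ultimately have pc': "c' - ?p = (r' / (r + r')) *\<^sub>R (c' - c)" by simp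
  have p: "dist c ?p = r" "dist c' ?p = r'"
    using assms(1,2) d norm_minus_commute[of c' c] unfolding dist_norm pc pc' by simp_all
  have "q = ?p" if "dist c q = r" "dist c' q = r'" for q
  proof -
    have "dist c c' = dist c q + dist q c'" using that d by (simp add: dist_commute)
    \<comment> \<open>Equality in the triangle inequality forces \<open>q\<close> onto the
      segment.\<close>
    then have "r *\<^sub>R (q - c') = r' *\<^sub>R (c - q)"
      unfolding dist_triangle_eq using that by (simp add: dist_norm norm_minus_commute)
    then have "(r + r') *\<^sub>R (q - c) = r *\<^sub>R (c' - c)" by (simp add: algebra_simps)
    moreover have "q - c = (1 / (r + r')) *\<^sub>R ((r + r') *\<^sub>R (q - c))" using pos by simp
    ultimately have "q - c = (r / (r + r')) *\<^sub>R (c' - c)" by simp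
    then show ?thesis by (simp add: algebra_simps)
  qed
  then have "sphere c r \<inter> sphere c' r' \<subseteq> {?p}" unfolding sphere_def by blast
  moreover have "?p \<in> sphere c r \<inter> sphere c' r'" unfolding sphere_def using p by blast
  ultimately have "sphere c r \<inter> sphere c' r' = {?p}" by blast
  moreover have "ball c r \<inter> ball c' r' = {}"
    using d by (intro disjoint_ballI) simp
  ultimately show ?thesis
    unfolding tangent_def interior_cball frontier_cball by blast
qed

lemma sphere_inter_unit_sphere:
  fixes c :: complex
  assumes "0 < r" "r < 1" "norm c = 1 - r"
  shows "sphere c r \<inter> sphere 0 1 = {c /\<^sub>R (1 - r)}"
proof -
  let ?p = "c /\<^sub>R (1 - r)"
  have n: "dist 0 ?p = 1" using assms by simp
  have "?p - c = (r / (1 - r)) *\<^sub>R c"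
    using assms by (simp add: complex_eq_iff field_simps)
  then have "norm (?p - c) = r" using assms by simp
  then have d: "dist c ?p = r" by (simp add: dist_norm norm_minus_commute)
  have "q = ?p" if "dist 0 q = 1" "dist c q = r" for q
  proof -
    have "dist 0 q = dist 0 c + dist c q" using that assms by simp
    \<comment> \<open>The same equality case, now with \<open>c\<close> between 0 and
      \<open>q\<close>.\<close>
    then have "(1 - r) *\<^sub>R (c - q) = r *\<^sub>R (0 - c)"
      unfolding dist_triangle_eq using that assms by (simp add: dist_norm)
    then have "(1 - r) *\<^sub>R q = c" by (simp add: algebra_simps)
    then show ?thesis using assms by auto
  qed
  then have "sphere c r \<inter> sphere 0 1 \<subseteq> {?p}" unfolding sphere_def by blast
  moreover have "?p \<in> sphere c r \<inter> sphere 0 1" unfolding sphere_def using n d by blast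
  ultimately show ?thesis by blast
qed

lemma frontier_exterior_disk: "frontier exterior_disk = sphere 0 1"
  by (simp add: exterior_disk_def frontier_complement)

lemma tangent_exterior_disk:
  fixes c :: complex
  assumes "0 < r" "r < 1" "norm c = 1 - r"
  shows "tangent (cball c r) exterior_disk"
proof -
  have "interior exterior_disk \<subseteq> - ball 0 1"
    unfolding exterior_disk_def by (rule interior_subset)
  moreover have "ball c r \<subseteq> ball 0 1"
    using assms by (simp add: ball_subset_ball_iff)
  ultimately have "interior (cball c r) \<inter> interior exterior_disk = {}"
    unfolding interior_cball by blast
  then show ?thesis
    using sphere_inter_unit_sphere[OF assms]
    unfolding tangent_def frontier_cball frontier_exterior_disk by blast
qed

section \<open>Disks inside the unit circle with integer parameters\<close>

text \<open>The real and imaginary part of \<open>(n + i k)\<^sup>2\<close>.\<close>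

definition spinor_point :: "int \<Rightarrow> int \<Rightarrow> complex" where
  "spinor_point n k = Complex (real_of_int (n\<^sup>2 - k\<^sup>2)) (real_of_int (2 * n * k))"

definition spinor_curvature :: "int \<Rightarrow> int \<Rightarrow> real" where
  "spinor_curvature n k = real_of_int (n\<^sup>2 + k\<^sup>2 + 1)"

definition spinor_disk :: "int \<Rightarrow> int \<Rightarrow> complex set" where
  "spinor_disk n k = cball (spinor_point n k /\<^sub>R spinor_curvature n k) (1 / spinor_curvature n k)"

text \<open>The second entry, curvature minus 2, encodes product 1 with the exterior vector
  \<open>(-1, 1, 0)\<close>.\<close>

definition spinor_vector :: "int \<Rightarrow> int \<Rightarrow> cvec" where
  "spinor_vector n k = (spinor_curvature n k, spinor_curvature n k - 2, spinor_point n k)"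

lemma spinor_curvature_ge_1: "spinor_curvature n k \<ge> 1"
  by (simp add: spinor_curvature_def)

lemma norm_spinor_point: "norm (spinor_point n k) = spinor_curvature n k - 1"
proof -
  have "(real_of_int (n\<^sup>2 - k\<^sup>2))\<^sup>2 + (real_of_int (2 * n * k))\<^sup>2 = (spinor_curvature n k - 1)\<^sup>2"
    by (simp add: spinor_curvature_def power2_eq_square algebra_simps)
  then show ?thesis
    using spinor_curvature_ge_1[of n k] by (simp add: spinor_point_def complex_norm)
qed

text \<open>Let w be n + ik times the conjugate of n' + ik'. The product is
  \<open>|w|^2 - Re (w^2) - 1\<close>, and \<open>|w|^2 - Re (w^2) = 2 (Im w)^2\<close>. Hence
  determinant 1 or -1 gives product 1.\<close>

lemma lorentz_spinor_vectors:
  "lorentz (spinor_vector n k) (spinor_vector n' k') = 2 * (real_of_int (n * k' - k * n'))\<^sup>2 - 1"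
  by (simp add: spinor_vector_def lorentz_def spinor_curvature_def spinor_point_def inner_complex_def
      power2_eq_square field_simps)

lemma lorentz_spinor_exterior: "lorentz (spinor_vector n k) (-1, 1, 0) = 1"
  by (simp add: spinor_vector_def lorentz_def)

lemma disk_of_spinor_vector: "disk_of (spinor_vector n k) = spinor_disk n k"
proof -
  let ?b = "spinor_curvature n k"
  have b: "?b > 0" using spinor_curvature_ge_1[of n k] by simp
  have "((norm (spinor_point n k /\<^sub>R ?b))\<^sup>2 - (1 / ?b)\<^sup>2) / (1 / ?b) = ?b - 2"
    using b by (simp add: norm_spinor_point power_mult_distrib field_simps power2_eq_square)
  then show ?thesis
    using disk_of_cball[of "1 / ?b" "spinor_point n k /\<^sub>R ?b"] b
    by (simp add: spinor_disk_def spinor_vector_def)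
qed

text \<open>The way back from products to geometry, for positive curvatures: expand the squared
  distance and insert the three products.\<close>

lemma dist_centers:
  assumes v: "lorentz (b, c, z) (b, c, z) = -1" and w: "lorentz (b', c', z') (b', c', z') = -1"
    and vw: "lorentz (b, c, z) (b', c', z') = 1" and pos: "b > 0" "b' > 0"
  shows "dist (z /\<^sub>R b) (z' /\<^sub>R b') = 1 / b + 1 / b'"
proof -
  have zz: "z \<bullet> z = 1 + b * c" "z' \<bullet> z' = 1 + b' * c'" "z \<bullet> z' = (b * c' + b' * c) / 2 - 1"
    using v w vw by (simp_all add: lorentz_def)
  have "(dist (z /\<^sub>R b) (z' /\<^sub>R b'))\<^sup>2
      = z \<bullet> z / b / b - 2 * (z \<bullet> z') / b / b' + z' \<bullet> z' / b' / b'"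
    unfolding dist_norm power2_norm_eq_inner
    by (simp add: inner_diff_left inner_diff_right inner_commute divide_inverse_commute)
  also have "\<dots> = (1 / b + 1 / b')\<^sup>2"
    unfolding zz using pos by (simp add: field_simps power2_eq_square)
  finally show ?thesis
    by (rule power2_eq_imp_eq) (use pos in auto)
qed

lemma tangent_spinor_disks:
  assumes "(n * k' - k * n')\<^sup>2 = 1"
  shows "tangent (spinor_disk n k) (spinor_disk n' k')"
proof -
  have "(real_of_int (n * k' - k * n'))\<^sup>2 = 1"
    using assms by (metis of_int_1 of_int_power)
  then have "lorentz (spinor_vector n k) (spinor_vector n' k') = 1"
    unfolding lorentz_spinor_vectors by simp
  moreover have "lorentz (spinor_vector n k) (spinor_vector n k) = -1"
    "lorentz (spinor_vector n' k') (spinor_vector n' k') = -1"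
    unfolding lorentz_spinor_vectors by simp_all
  ultimately have "dist (spinor_point n k /\<^sub>R spinor_curvature n k) (spinor_point n' k' /\<^sub>R spinor_curvature n' k')
      = 1 / spinor_curvature n k + 1 / spinor_curvature n' k'"
    unfolding spinor_vector_def using spinor_curvature_ge_1[of n k] spinor_curvature_ge_1[of n' k']
    by (intro dist_centers) auto
  then show ?thesis
    unfolding spinor_disk_def using spinor_curvature_ge_1[of n k] spinor_curvature_ge_1[of n' k']
    by (intro tangent_cballs) auto
qed

lemma spinor_disk_radius_center:
  assumes "(n, k) \<noteq> (0, 0)"
  shows "0 < 1 / spinor_curvature n k" "1 / spinor_curvature n k < 1"
    "norm (spinor_point n k /\<^sub>R spinor_curvature n k) = 1 - 1 / spinor_curvature n k"
proof -
  have "n\<^sup>2 + k\<^sup>2 > 0" using assms by (simp add: sum_power2_gt_zero_iff)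
  then have "spinor_curvature n k > 1" unfolding spinor_curvature_def by linarith
  then show "0 < 1 / spinor_curvature n k" "1 / spinor_curvature n k < 1"
    "norm (spinor_point n k /\<^sub>R spinor_curvature n k) = 1 - 1 / spinor_curvature n k"
    by (simp_all add: norm_spinor_point field_simps)
qed

lemma tangent_spinor_exterior:
  assumes "(n, k) \<noteq> (0, 0)"
  shows "tangent (spinor_disk n k) exterior_disk"
  unfolding spinor_disk_def by (intro tangent_exterior_disk spinor_disk_radius_center assms)

lemma frontier_spinor_disk_inter_sphere:
  assumes "(n, k) \<noteq> (0, 0)"
  shows "frontier (spinor_disk n k) \<inter> sphere 0 1 = {spinor_point n k /\<^sub>R (spinor_curvature n k - 1)}"
proof -
  let ?b = "spinor_curvature n k"
  have "?b > 1" using spinor_disk_radius_center(2)[OF assms] spinor_curvature_ge_1[of n k]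
    by (simp add: field_simps)
  then have "(spinor_point n k /\<^sub>R ?b) /\<^sub>R (1 - 1 / ?b) = spinor_point n k /\<^sub>R (?b - 1)"
    by (simp add: field_simps)
  then show ?thesis
    unfolding spinor_disk_def frontier_cball
    using sphere_inter_unit_sphere[OF spinor_disk_radius_center[OF assms]] by simp
qed

section \<open>Euclid's algorithm inside the packing\<close>

definition in_window :: "int \<Rightarrow> int \<Rightarrow> bool" where
  "in_window n k \<longleftrightarrow> spinor_disk n k \<in> apollonian_window \<and> spinor_vector n k \<in> circle_vectors"

lemma exterior_in_window: "exterior_disk \<in> apollonian_window"
  unfolding apollonian_window_def by (rule seed) simp

lemma spinor_uminus:
  "spinor_disk (- n) (- k) = spinor_disk n k" "spinor_vector (- n) (- k) = spinor_vector n k"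
  by (simp_all add: spinor_disk_def spinor_vector_def spinor_point_def spinor_curvature_def)

lemma in_window_uminus: "in_window (- n) (- k) \<longleftrightarrow> in_window n k"
  by (simp add: in_window_def spinor_uminus)

lemma in_window_seeds: "in_window 1 0" "in_window 0 1" "in_window 0 (-1)"
proof -
  have "spinor_disk 1 0 = cball (Complex (1/2) 0) (1/2)" "spinor_disk 0 1 = cball (Complex (-1/2) 0) (1/2)"
    by (simp_all add: spinor_disk_def spinor_point_def spinor_curvature_def scaleR_complex.ctr)
  moreover have "spinor_vector 1 0 = (2, 0, 1)" "spinor_vector 0 1 = (2, 0, -1)"
    by (simp_all add: spinor_vector_def spinor_point_def spinor_curvature_def complex_eq_iff)
  ultimately show a: "in_window 1 0" "in_window 0 1"
    unfolding in_window_def apollonian_window_def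
    using right_vector left_vector by (auto intro: apollonian_packing.seed)
  show "in_window 0 (-1)" using a(2) in_window_uminus[of 0 1] by simp
qed

text \<open>A Farey mediant as one Apollonian step: its determinants with both given pairs are again
  1 or -1, so the new disk is tangent to both old ones and to the exterior disk.\<close>

lemma in_window_add:
  assumes "in_window n k" "in_window n' k'" and det: "(n * k' - k * n')\<^sup>2 = 1"
  shows "in_window (n + n') (k + k')"
proof -
  have det1: "((n + n') * k - (k + k') * n)\<^sup>2 = 1" and det2: "((n + n') * k' - (k + k') * n')\<^sup>2 = 1"
    using det by (simp_all add: power2_eq_square algebra_simps)
  have nz: "(n, k) \<noteq> (0, 0)" "(n', k') \<noteq> (0, 0)" "(n + n', k + k') \<noteq> (0, 0)"
    using det det1 by auto
  have "spinor_disk (n + n') (k + k') \<in> apollonian_window"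
    unfolding apollonian_window_def
  proof (rule adjoin)
    show "spinor_disk n k \<in> apollonian_packing {exterior_disk, cball (Complex (1/2) 0) (1/2), cball (Complex (-1/2) 0) (1/2)}"
      "spinor_disk n' k' \<in> apollonian_packing {exterior_disk, cball (Complex (1/2) 0) (1/2), cball (Complex (-1/2) 0) (1/2)}"
      "exterior_disk \<in> apollonian_packing {exterior_disk, cball (Complex (1/2) 0) (1/2), cball (Complex (-1/2) 0) (1/2)}"
      using assms exterior_in_window by (simp_all add: in_window_def apollonian_window_def)
    show "tangent (spinor_disk n k) (spinor_disk n' k')"
      "tangent (spinor_disk (n + n') (k + k')) (spinor_disk n k)"
      "tangent (spinor_disk (n + n') (k + k')) (spinor_disk n' k')"
      by (rule tangent_spinor_disks[OF det] tangent_spinor_disks[OF det1] tangent_spinor_disks[OF det2])+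
    show "tangent (spinor_disk n k) exterior_disk" "tangent (spinor_disk n' k') exterior_disk"
      "tangent (spinor_disk (n + n') (k + k')) exterior_disk"
      by (rule nz[THEN tangent_spinor_exterior])+
    show "disk (spinor_disk (n + n') (k + k'))"
      unfolding disk_def spinor_disk_def using spinor_disk_radius_center(1)[OF nz(3)] by blast
  qed
  moreover have "spinor_vector (n + n') (k + k') \<in> circle_vectors"
  proof (rule circle_vectors_closed)
    show "spinor_vector n k \<in> circle_vectors" "spinor_vector n' k' \<in> circle_vectors"
      "(-1, 1, 0) \<in> circle_vectors"
      using assms exterior_vector by (simp_all add: in_window_def)
    show "lorentz (spinor_vector n k) (-1, 1, 0) = 1" "lorentz (spinor_vector n' k') (-1, 1, 0) = 1"
      "lorentz (spinor_vector (n + n') (k + k')) (-1, 1, 0) = 1"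
      by (rule lorentz_spinor_exterior)+
    have "lorentz (spinor_vector a b) (spinor_vector a' b') = 1" if "(a * b' - b * a')\<^sup>2 = 1" for a b a' b'
    proof -
      have "(real_of_int (a * b' - b * a'))\<^sup>2 = 1" using that by (metis of_int_1 of_int_power)
      then show ?thesis unfolding lorentz_spinor_vectors by simp
    qed
    then show "lorentz (spinor_vector n k) (spinor_vector n' k') = 1"
      "lorentz (spinor_vector (n + n') (k + k')) (spinor_vector n k) = 1"
      "lorentz (spinor_vector (n + n') (k + k')) (spinor_vector n' k') = 1"
      using det det1 det2 by blast+
    show "lorentz (spinor_vector (n + n') (k + k')) (spinor_vector (n + n') (k + k')) = -1"
      unfolding lorentz_spinor_vectors by simp
  qed
  ultimately show ?thesis by (simp add: in_window_def)
qed

text \<open>Euclid's subtractive algorithm on the determinant 1 matrix with columns (a, b) and (c,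
  d): take the smaller column from the larger one, down to the identity. The sign \<open>e\<close>
  treats parameters of opposite signs at the same time.\<close>

lemma in_window_unimodular:
  fixes a b c d :: nat and e :: int
  assumes "e \<in> {1, -1}" "a * d = b * c + 1"
  shows "in_window (int a) (e * int b) \<and> in_window (int c) (e * int d)"
  using assms(2)
proof (induction "a + b + c + d" arbitrary: a b c d rule: less_induct)
  case less
  have e2: "e * e = 1" using assms(1) by auto
  \<comment> \<open>Positivity makes every subtraction lower the sum
    \<open>a + b + c + d\<close>.\<close>
  have ad: "a > 0" "d > 0" using less.prems by (auto intro: Nat.gr0I)
  have det: "(int n * (e * int k') - e * int k * int n')\<^sup>2 = 1"
    if "n * k' = k * n' + 1" for n k n' k' :: nat
  proof -
    have "int n * int k' - int k * int n' = 1" using arg_cong[OF that, of int] by simp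
    then have "int n * (e * int k') - e * int k * int n' = e" by (simp add: algebra_simps flip: right_diff_distrib)
    then show ?thesis using e2 by (simp add: power2_eq_square)
  qed
  \<comment> \<open>If neither column dominates, then \<open>c < a\<close> and \<open>b < d\<close>,
    so \<open>(c + 1) * (b + 1) \<le> b * c + 1\<close> and \<open>b = c = 0\<close>.\<close>
  consider "b = 0" "c = 0" | "c \<le> a" "d \<le> b" | "a \<le> c" "b \<le> d"
  proof (cases "a \<le> c")
    case True
    then have "b * c + 1 \<le> c * d" using less.prems mult_le_mono1[of a c d] by simp
    then have "b * c < d * c" using mult.commute[of c d] by linarith
    then have "b < d" by (simp only: mult_less_cancel2)
    then show ?thesis using True that(3) by simp
  next
    case False
    show ?thesis
    proof (cases "d \<le> b")
      case True
      then show ?thesis using False that(2) by simp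
    next
      case F: False
      have "(c + 1) * (b + 1) \<le> a * d" using False F by (intro mult_le_mono) auto
      then have "b = 0" "c = 0" using less.prems by (simp_all add: algebra_simps)
      then show ?thesis using that(1) by simp
    qed
  qed
  then show ?case
  proof cases
    case 1
    then have "a = 1" "d = 1" using less.prems by auto
    then show ?thesis using 1 in_window_seeds assms(1) by auto
  next
    case 2
    have eq: "(a - c) * d = (b - d) * c + 1"
    proof -
      obtain a' b' where "a = c + a'" "b = d + b'" using 2 by (auto simp: le_iff_add)
      then show ?thesis using less.prems by (simp add: algebra_simps)
    qed
    then have IH: "in_window (int (a - c)) (e * int (b - d))" "in_window (int c) (e * int d)"
      using less.hyps[of "a - c" "b - d" c d] 2 ad by auto
    then have "in_window (int (a - c) + int c) (e * int (b - d) + e * int d)"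
      using det[OF eq] by (rule in_window_add)
    then show ?thesis using IH 2 by (simp add: of_nat_diff algebra_simps)
  next
    case 3
    have eq: "a * (d - b) = b * (c - a) + 1"
    proof -
      obtain c' d' where "c = a + c'" "d = b + d'" using 3 by (auto simp: le_iff_add)
      then show ?thesis using less.prems by (simp add: algebra_simps)
    qed
    then have IH: "in_window (int a) (e * int b)" "in_window (int (c - a)) (e * int (d - b))"
      using less.hyps[of a b "c - a" "d - b"] 3 ad by auto
    then have "in_window (int a + int (c - a)) (e * int b + e * int (d - b))"
      using det[OF eq] by (rule in_window_add)
    then show ?thesis using IH 3 by (simp add: of_nat_diff algebra_simps)
  qed
qed

text \<open>Bezout coefficients complete the pair to a matrix of determinant 1.\<close>

lemma in_window_coprime:
  assumes "coprime n k"
  shows "in_window n k"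
proof -
  have *: "in_window (int n) (e * int k)" if "coprime n k" "e \<in> {1, -1}" for n k :: nat and e :: int
  proof (cases "n = 0")
    case True
    \<comment> \<open>Coprimality with 0 forces \<open>k = 1\<close>.\<close>
    then show ?thesis using that in_window_seeds by auto
  next
    case False
    then obtain g x y where g: "g dvd n" "g dvd k" "n * x = k * y + g"
      using bezout_add_strong_nat by blast
    then have "g = 1" using that(1) by (metis coprime_common_divisor_nat nat_dvd_1_iff_1)
    then show ?thesis using in_window_unimodular[OF that(2), of n x k y] g by simp
  qed
  have cop: "coprime (nat \<bar>n\<bar>) (nat \<bar>k\<bar>)" using assms by (simp add: coprime_int_iff[symmetric])
  \<comment> \<open>The relative sign of the parameters; negating both leaves the disk
    unchanged.\<close>
  define e :: int where "e = (if (n \<ge> 0) = (k \<ge> 0) then 1 else -1)"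
  have "in_window \<bar>n\<bar> (e * \<bar>k\<bar>)" using *[OF cop, of e] by (simp add: e_def)
  moreover have "(\<bar>n\<bar>, e * \<bar>k\<bar>) = (n, k) \<or> (\<bar>n\<bar>, e * \<bar>k\<bar>) = (- n, - k)" by (auto simp: e_def)
  ultimately show ?thesis using in_window_uminus by fastforce
qed

section \<open>The corona of the exterior disk\<close>

text \<open>\<open>(n, k)\<close> is the direction of \<open>(m + x, y)\<close>, a square root of \<open>x + i y\<close> up to a positive factor.\<close>

lemma rational_point_spinor:
  fixes x y m :: int
  assumes "m > 0" "x\<^sup>2 + y\<^sup>2 = m\<^sup>2"
  obtains n k where "coprime n k"
    "m * (n\<^sup>2 - k\<^sup>2) = x * (n\<^sup>2 + k\<^sup>2)" "m * (2 * n * k) = y * (n\<^sup>2 + k\<^sup>2)"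
proof (cases "m + x = 0")
  case True
  then have "x = - m" by simp
  moreover have "y = 0" using assms(2) \<open>x = - m\<close> by simp
  \<comment> \<open>The direction \<open>(m + x, y)\<close> degenerates here; the root i of -1
    supplies the pair (0, 1).\<close>
  ultimately show ?thesis using that[of 0 1] by simp
next
  case False
  define g where "g = gcd (m + x) y"
  have g: "g \<noteq> 0" using False by (simp add: g_def)
  then obtain n k where nk: "m + x = n * g" "y = k * g" "coprime n k"
    using gcd_coprime_exists[of "m + x" y] unfolding g_def by blast
  \<comment> \<open>Gives \<open>(m + x)^2 + y^2 = 2 m (m + x)\<close> and
    \<open>(m + x)^2 - y^2 = 2 x (m + x)\<close>, from which both identities follow.\<close>
  have yy: "y * y = (m + x) * (m - x)" using assms(2) by (simp add: power2_eq_square algebra_simps)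
  have "g\<^sup>2 * (m * (n\<^sup>2 - k\<^sup>2)) = m * ((m + x)\<^sup>2 - y * y)"
    unfolding nk(1,2) by (simp add: power2_eq_square algebra_simps)
  also have "\<dots> = x * ((m + x)\<^sup>2 + y * y)"
    unfolding yy by (simp add: power2_eq_square algebra_simps)
  also have "\<dots> = g\<^sup>2 * (x * (n\<^sup>2 + k\<^sup>2))"
    unfolding nk(1,2) by (simp add: power2_eq_square algebra_simps)
  finally have 1: "m * (n\<^sup>2 - k\<^sup>2) = x * (n\<^sup>2 + k\<^sup>2)" using g by simp
  have "g\<^sup>2 * (m * (2 * n * k)) = m * (2 * (m + x) * y)"
    unfolding nk(1,2) by (simp add: power2_eq_square algebra_simps)
  also have "\<dots> = y * ((m + x)\<^sup>2 + y * y)"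
    unfolding yy by (simp add: power2_eq_square algebra_simps)
  also have "\<dots> = y * (g\<^sup>2 * (n\<^sup>2 + k\<^sup>2))"
    unfolding nk(1,2) by (simp add: power2_eq_square algebra_simps)
  finally have "g\<^sup>2 * (m * (2 * n * k)) = g\<^sup>2 * (y * (n\<^sup>2 + k\<^sup>2))" by (simp only: mult.left_commute)
  then have "m * (2 * n * k) = y * (n\<^sup>2 + k\<^sup>2)" using g by simp
  then show ?thesis using that nk(3) 1 by blast
qed

text \<open>Integrality turns the norm equation into a Pythagorean one, hence into a pair
  \<open>(n, k)\<close> with the same touching point. Internal tangency there gives product -1, and
  \<open>circle_vectors_disjoint\<close> identifies the two vectors.\<close>

lemma circle_vector_tangent_exterior:
  assumes v: "v \<in> circle_vectors" "lorentz v (-1, 1, 0) = 1"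
  obtains n k where "coprime n k" "v = spinor_vector n k"
proof -
  obtain b c z where bcz: "v = (b, c, z)" by (cases v) auto
  have c: "c = b - 2" using v(2) by (simp add: bcz lorentz_def)
  have norm: "z \<bullet> z = (b - 1)\<^sup>2"
    using circle_vectors_normalized[OF v(1)] by (simp add: bcz lorentz_self c power2_eq_square algebra_simps)
  have b: "b > 1"
  proof (cases "v = (2, 0, 1) \<or> v = (2, 0, -1)")
    case True
    then show ?thesis by (auto simp: bcz)
  next
    case False
    \<comment> \<open>These read \<open>b - 2 - Re z \<ge> 1\<close> and
      \<open>b - 2 + Re z \<ge> 1\<close>; adding them gives \<open>b \<ge> 3\<close>.\<close>
    then have "lorentz v (2, 0, 1) \<ge> 1" "lorentz v (2, 0, -1) \<ge> 1"
      using circle_vectors_disjoint v(1) left_vector right_vector by blast+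
    then show ?thesis by (simp add: bcz lorentz_def c inner_complex_def field_simps)
  qed
  have "fst v \<in> \<int>" "Re (snd (snd v)) \<in> \<int>" "Im (snd (snd v)) \<in> \<int>"
    using circle_vectors_integral[OF v(1)] by auto
  then obtain bi x y where int: "b = of_int bi" "Re z = of_int x" "Im z = of_int y"
    unfolding bcz by (auto elim!: Ints_cases)
  define m where "m = bi - 1"
  have m: "m > 0" "b = of_int m + 1" using b int by (simp_all add: m_def)
  have "of_int (x\<^sup>2 + y\<^sup>2) = (of_int (m\<^sup>2) :: real)"
    using norm by (simp add: inner_complex_def int m_def power2_eq_square)
  then have pyth: "x\<^sup>2 + y\<^sup>2 = m\<^sup>2" by (simp only: of_int_eq_iff)
  obtain n k where cop: "coprime n k"
    and x: "m * (n\<^sup>2 - k\<^sup>2) = x * (n\<^sup>2 + k\<^sup>2)" and y: "m * (2 * n * k) = y * (n\<^sup>2 + k\<^sup>2)"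
    using rational_point_spinor[OF m(1) pyth] .
  let ?N = "real_of_int (n\<^sup>2 + k\<^sup>2)" and ?m = "real_of_int m"
  have N: "?N \<noteq> 0"
  proof
    assume "?N = 0"
    then have "n\<^sup>2 + k\<^sup>2 = 0" by (simp only: of_int_eq_0_iff)
    then have "n = 0 \<and> k = 0" by (simp only: sum_power2_eq_zero_iff)
    with cop show False by simp
  qed
  have x': "Re z * ?N = ?m * real_of_int (n\<^sup>2 - k\<^sup>2)" and y': "Im z * ?N = ?m * real_of_int (2 * n * k)"
    unfolding int of_int_mult[symmetric] x y by (rule refl)+
  \<comment> \<open>The inner product turns out to be the product of the norms \<open>?m\<close> and
    \<open>?N\<close>, so the two vectors point the same way.\<close>
  have "?N * (z \<bullet> spinor_point n k)
      = (Re z * ?N) * real_of_int (n\<^sup>2 - k\<^sup>2) + (Im z * ?N) * real_of_int (2 * n * k)"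
    by (simp add: spinor_point_def inner_complex_def algebra_simps)
  also have "\<dots> = ?N * (?m * ?N)"
    unfolding x' y' by (simp add: power2_eq_square algebra_simps)
  finally have "z \<bullet> spinor_point n k = ?m * ?N" using N by (simp only: mult_cancel_left) blast
  then have "lorentz v (spinor_vector n k) = -1"
    unfolding bcz c m(2) by (simp add: lorentz_def spinor_vector_def spinor_curvature_def field_simps)
  moreover have "spinor_vector n k \<in> circle_vectors"
    using in_window_coprime[OF cop] by (simp add: in_window_def)
  ultimately have "v = spinor_vector n k"
    using circle_vectors_disjoint[OF v(1), of "spinor_vector n k"] by linarith
  then show ?thesis using that cop by blast
qed

lemma coprime_nonzero: "coprime n k \<Longrightarrow> (n, k) \<noteq> (0, 0)" for n k :: int
  by auto

lemma corona_exterior_disk: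
  "corona apollonian_window exterior_disk = {spinor_disk n k | n k. coprime n k}"
proof (intro equalityI subsetI)
  fix E assume "E \<in> corona apollonian_window exterior_disk"
  then have E: "E \<in> apollonian_window" "tangent E exterior_disk" by (auto simp: corona_def)
  then obtain v where v: "v \<in> circle_vectors" "E = disk_of v" using apollonian_window_subset by blast
  have "tangent (disk_of v) (disk_of (-1, 1, 0))" using E(2) v(2) disk_of_exterior_vector by simp
  then have "lorentz v (-1, 1, 0) = 1"
    by (rule tangent_imp_lorentz[OF circle_vectors_normalized[OF v(1)] circle_vectors_normalized[OF exterior_vector]])
  then obtain n k where "coprime n k" "v = spinor_vector n k"
    using circle_vector_tangent_exterior[OF v(1)] by blast
  then show "E \<in> {spinor_disk n k | n k. coprime n k}"
    using v(2) disk_of_spinor_vector by blast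
next
  fix E assume "E \<in> {spinor_disk n k | n k. coprime n k}"
  then obtain n k where nk: "coprime n k" "E = spinor_disk n k" by blast
  then show "E \<in> corona apollonian_window exterior_disk"
    using in_window_coprime[OF nk(1)] tangent_spinor_exterior[OF coprime_nonzero[OF nk(1)]]
    by (simp add: corona_def in_window_def)
qed

section \<open>The quarters and their indexing by coprime pairs\<close>

lemma spinor_disk_in_quarter:
  assumes "coprime n k"
  shows "spinor_disk n k \<in> quarter s t \<longleftrightarrow>
    s * real_of_int (n\<^sup>2 - k\<^sup>2) \<ge> 0 \<and> t * real_of_int (n * k) \<ge> 0"
proof -
  let ?b = "spinor_curvature n k - 1"
  let ?x = "real_of_int (n\<^sup>2 - k\<^sup>2) / ?b" and ?y = "2 * real_of_int (n * k) / ?b"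
  have b: "?b > 0"
    using spinor_disk_radius_center(2)[OF coprime_nonzero[OF assms]] spinor_curvature_ge_1[of n k]
    by (simp add: field_simps)
  \<comment> \<open>The touching point is unique, so the existential in \<open>quarter\<close>
    reduces to the signs of its coordinates.\<close>
  have point: "frontier (spinor_disk n k) \<inter> sphere 0 1 = {Complex ?x ?y}"
    unfolding frontier_spinor_disk_inter_sphere[OF coprime_nonzero[OF assms]]
    by (simp add: spinor_point_def complex_eq_iff divide_inverse_commute)
  have mem: "Complex x y \<in> frontier (spinor_disk n k) \<inter> sphere 0 1 \<longleftrightarrow> x = ?x \<and> y = ?y" for x y
    unfolding point singleton_iff complex.inject ..
  have "spinor_disk n k \<in> corona apollonian_window exterior_disk"
    using corona_exterior_disk assms by blast
  then have "spinor_disk n k \<in> quarter s t \<longleftrightarrow> s * ?x \<ge> 0 \<and> t * ?y \<ge> 0"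
    unfolding quarter_def mem_Collect_eq mem by simp
  moreover have "s * ?x = s * real_of_int (n\<^sup>2 - k\<^sup>2) / ?b" "t * ?y = 2 * (t * real_of_int (n * k)) / ?b"
    by simp_all
  ultimately show ?thesis using b by (simp only: zero_le_divide_iff) (auto simp: mult_ac)
qed

lemma area_spinor_disk: "area (spinor_disk n k) = pi * (1 / (spinor_curvature n k)\<^sup>2)"
proof -
  have "1 / spinor_curvature n k \<ge> 0" using spinor_curvature_ge_1[of n k] by simp
  then show ?thesis
    unfolding area_def spinor_disk_def
    by (simp add: content_cball unit_ball_vol_2 power_divide)
qed

text \<open>Radius and real part of the center determine the squares of both parameters. On
  \<open>coprime_pairs\<close>, where both are nonnegative, this yields injectivity.\<close>

lemma spinor_disk_eqD:
  assumes "spinor_disk n k = spinor_disk n' k'"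
  shows "n\<^sup>2 + k\<^sup>2 = n'\<^sup>2 + k'\<^sup>2" "n\<^sup>2 - k\<^sup>2 = n'\<^sup>2 - k'\<^sup>2"
proof -
  have pos: "spinor_curvature n k > 0" "spinor_curvature n' k' > 0"
    using spinor_curvature_ge_1[of n k] spinor_curvature_ge_1[of n' k'] by linarith+
  have "1 / spinor_curvature n k = 1 / spinor_curvature n' k'"
    and c: "spinor_point n k /\<^sub>R spinor_curvature n k = spinor_point n' k' /\<^sub>R spinor_curvature n' k'"
    using assms pos unfolding spinor_disk_def cball_eq_cball_iff
    by (auto simp: field_simps divide_less_0_iff)
  then have b: "spinor_curvature n k = spinor_curvature n' k'" by simp
  then show "n\<^sup>2 + k\<^sup>2 = n'\<^sup>2 + k'\<^sup>2"
    unfolding spinor_curvature_def of_int_eq_iff by linarith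
  have "Re (spinor_point n k) = Re (spinor_point n' k')" using c b pos by simp
  then show "n\<^sup>2 - k\<^sup>2 = n'\<^sup>2 - k'\<^sup>2"
    unfolding spinor_point_def complex.sel of_int_eq_iff .
qed

text \<open>
  Negating \<open>k\<close> reflects the disk in the real axis; exchanging \<open>n\<close> and \<open>k\<close> reflects it in the
  imaginary axis.
\<close>

definition quarter_disk :: "real \<Rightarrow> real \<Rightarrow> int \<times> int \<Rightarrow> complex set" where
  "quarter_disk s t = (\<lambda>(n, k).
     if s = 1 then spinor_disk n (if t = 1 then k else - k)
     else spinor_disk k (if t = 1 then n else - n))"

lemma area_quarter_disk:
  "area (quarter_disk s t (n, k)) = pi * (1 / (real_of_int (n\<^sup>2 + k\<^sup>2 + 1))\<^sup>2)"
  by (simp add: quarter_disk_def area_spinor_disk spinor_curvature_def add.commute)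

lemma inj_on_quarter_disk: "inj_on (quarter_disk s t) coprime_pairs"
proof (rule inj_onI)
  fix p q assume pq: "p \<in> coprime_pairs" "q \<in> coprime_pairs" and eq: "quarter_disk s t p = quarter_disk s t q"
  obtain n k n' k' where [simp]: "p = (n, k)" "q = (n', k')" by (cases p, cases q) auto
  have "n\<^sup>2 + k\<^sup>2 = n'\<^sup>2 + k'\<^sup>2 \<and> n\<^sup>2 - k\<^sup>2 = n'\<^sup>2 - k'\<^sup>2"
  proof (cases "s = 1")
    case True
    then have "spinor_disk n (if t = 1 then k else - k) = spinor_disk n' (if t = 1 then k' else - k')"
      using eq by (simp add: quarter_disk_def)
    from spinor_disk_eqD[OF this] show ?thesis by (auto split: if_splits)
  next
    case False
    then have "spinor_disk k (if t = 1 then n else - n) = spinor_disk k' (if t = 1 then n' else - n')"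
      using eq by (simp add: quarter_disk_def)
    from spinor_disk_eqD[OF this] show ?thesis by (auto split: if_splits)
  qed
  then have "n\<^sup>2 = n'\<^sup>2" "k\<^sup>2 = k'\<^sup>2" by linarith+
  then show "p = q" using pq by (auto simp: coprime_pairs_def power2_eq_iff_nonneg)
qed

lemma quarter_disk_image:
  assumes st: "s \<in> {1, -1}" "t \<in> {1, -1}"
  shows "quarter_disk s t ` coprime_pairs = quarter s t"
proof (intro equalityI subsetI)
  fix E assume "E \<in> quarter_disk s t ` coprime_pairs"
  then obtain n k where nk: "0 \<le> k" "k \<le> n" "coprime n k" "E = quarter_disk s t (n, k)"
    by (auto simp: coprime_pairs_def coprime_iff_gcd_eq_1)
  have sq: "k\<^sup>2 \<le> n\<^sup>2" using nk by (intro power_mono)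
  have pr: "0 \<le> n * k" using nk by simp
  \<comment> \<open>\<open>m\<close> and \<open>l\<close> are the parameters inside
    \<open>quarter_disk\<close>, with the sign of \<open>l\<close> as an explicit factor.\<close>
  define m where "m = (if s = 1 then n else k)"
  define l where "l = (if t = 1 then 1 else -1) * (if s = 1 then k else n)"
  have "E = spinor_disk m l" using nk(4) by (simp add: quarter_disk_def m_def l_def)
  moreover have "coprime m l" using nk(3) by (auto simp: m_def l_def coprime_commute)
  moreover have "s * real_of_int (m\<^sup>2 - l\<^sup>2) = real_of_int (n\<^sup>2 - k\<^sup>2)"
    "t * real_of_int (m * l) = real_of_int (n * k)"
    using st by (auto simp: m_def l_def)
  ultimately show "E \<in> quarter s t"
    using spinor_disk_in_quarter[of m l s t] sq pr by (simp only: of_int_0_le_iff) simp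
next
  fix E assume E: "E \<in> quarter s t"
  then obtain m l where ml: "coprime m l" "E = spinor_disk m l"
    using corona_exterior_disk unfolding quarter_def by blast
  have ge: "s * real_of_int (m\<^sup>2 - l\<^sup>2) \<ge> 0" "t * real_of_int (m * l) \<ge> 0"
    using E spinor_disk_in_quarter[OF ml(1)] ml(2) by blast+
  define n where "n = (if s = 1 then \<bar>m\<bar> else \<bar>l\<bar>)"
  define k where "k = (if s = 1 then \<bar>l\<bar> else \<bar>m\<bar>)"
  have "coprime n k" using ml(1) by (auto simp: n_def k_def coprime_commute)
  moreover have "k \<le> n"
  proof -
    have "if s = 1 then l\<^sup>2 \<le> m\<^sup>2 else m\<^sup>2 \<le> l\<^sup>2" using ge(1) st(1) by (auto simp flip: of_int_power)
    then show ?thesis by (auto simp: n_def k_def abs_le_square_iff split: if_splits)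
  qed
  ultimately have "(n, k) \<in> coprime_pairs"
    by (auto simp: coprime_pairs_def coprime_iff_gcd_eq_1 n_def k_def)
  moreover have "quarter_disk s t (n, k) = spinor_disk \<bar>m\<bar> (if t = 1 then \<bar>l\<bar> else - \<bar>l\<bar>)"
    by (simp add: quarter_disk_def n_def k_def)
  moreover have "spinor_disk \<bar>m\<bar> (if t = 1 then \<bar>l\<bar> else - \<bar>l\<bar>) = spinor_disk m l"
  proof -
    have "spinor_point \<bar>m\<bar> (if t = 1 then \<bar>l\<bar> else - \<bar>l\<bar>) = spinor_point m l"
    proof -
      \<comment> \<open>Given the absolute values, only the sign of \<open>m * l\<close> matters,
        because \<open>(m + i l)^2\<close> has imaginary part \<open>2 m l\<close>.\<close>
      have "if t = 1 then m * l \<ge> 0 else m * l \<le> 0" using ge(2) st(2) by (auto simp flip: of_int_mult)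
      then have "\<bar>m\<bar> * (if t = 1 then \<bar>l\<bar> else - \<bar>l\<bar>) = m * l"
        by (auto simp: abs_mult[symmetric] split: if_splits)
      then have im: "2 * \<bar>m\<bar> * (if t = 1 then \<bar>l\<bar> else - \<bar>l\<bar>) = 2 * m * l" by (simp only: mult.assoc)
      have re: "\<bar>m\<bar>\<^sup>2 - (if t = 1 then \<bar>l\<bar> else - \<bar>l\<bar>)\<^sup>2 = m\<^sup>2 - l\<^sup>2" by simp
      show ?thesis unfolding spinor_point_def im re ..
    qed
    moreover have "spinor_curvature \<bar>m\<bar> (if t = 1 then \<bar>l\<bar> else - \<bar>l\<bar>) = spinor_curvature m l"
      by (simp add: spinor_curvature_def)
    ultimately show ?thesis unfolding spinor_disk_def by simp
  qed
  ultimately show "E \<in> quarter_disk s t ` coprime_pairs"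
    unfolding ml(2) by (intro image_eqI[of _ _ "(n, k)"]) (simp only:)
qed

section \<open>Convergence of the sum\<close>

lemma summable_on_coprime_pairs:
  "(\<lambda>(n, k). 1 / (real_of_int (n\<^sup>2 + k\<^sup>2 + 1))\<^sup>2) summable_on coprime_pairs"
proof (rule nonneg_bdd_above_summable_on)
  \<comment> \<open>By \<open>(n^2 + 1) (k^2 + 1) \<le> (n^2 + k^2 + 1)^2\<close> the double sum is
    dominated by the square of the single sum of \<open>a\<close>.\<close>
  define a where "a n = 1 / (real_of_int n ^ 2 + 1)" for n
  have a0: "a n \<ge> 0" for n by (simp add: a_def)
  have "summable (\<lambda>i. a (int i))"
  proof (rule summable_comparison_test')
    show "summable (\<lambda>i. inverse (real i ^ 2))" by (rule inverse_power_summable) simp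
    \<comment> \<open>The bound starts at 1, since \<open>inverse 0 = 0\<close> while
      \<open>a 0 = 1\<close>.\<close>
    show "norm (a (int i)) \<le> inverse (real i ^ 2)" if "i \<ge> 1" for i
      using that by (auto simp: a_def divide_inverse intro!: le_imp_inverse_le)
  qed
  then have partial: "(\<Sum>n\<in>{0..int M}. a n) \<le> (\<Sum>i. a (int i))" for M
  proof -
    assume sm: "summable (\<lambda>i. a (int i))"
    have "{0..int M} = int ` {..M}" by (simp add: atMost_atLeast0 image_int_atLeastAtMost)
    then have "(\<Sum>n\<in>{0..int M}. a n) = (\<Sum>i\<in>{..M}. a (int i))"
      by (simp add: sum.reindex)
    also have "\<dots> \<le> (\<Sum>i. a (int i))" by (rule sum_le_suminf[OF sm]) (auto simp: a0)
    finally show ?thesis .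
  qed
  have le: "1 / (real_of_int (n\<^sup>2 + k\<^sup>2 + 1))\<^sup>2 \<le> a n * a k" for n k
  proof -
    have "(real_of_int n ^ 2 + 1) * (real_of_int k ^ 2 + 1)
        \<le> (real_of_int (n\<^sup>2 + k\<^sup>2 + 1)) * (real_of_int (n\<^sup>2 + k\<^sup>2 + 1))"
      by (intro mult_mono) auto
    moreover have "(real_of_int n ^ 2 + 1) * (real_of_int k ^ 2 + 1) > 0"
      by (intro mult_pos_pos) (auto intro: add_nonneg_pos)
    ultimately have "1 / (real_of_int (n\<^sup>2 + k\<^sup>2 + 1))\<^sup>2 \<le> 1 / ((real_of_int n ^ 2 + 1) * (real_of_int k ^ 2 + 1))"
      unfolding power2_eq_square[of "real_of_int (n\<^sup>2 + k\<^sup>2 + 1)"] by (intro divide_left_mono) auto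
    then show ?thesis by (simp add: a_def)
  qed
  show "bdd_above (sum (\<lambda>(n, k). 1 / (real_of_int (n\<^sup>2 + k\<^sup>2 + 1))\<^sup>2) ` {F. F \<subseteq> coprime_pairs \<and> finite F})"
  proof (rule bdd_aboveI2)
    fix F assume "F \<in> {F. F \<subseteq> coprime_pairs \<and> finite F}"
    then have F: "F \<subseteq> coprime_pairs" "finite F" by auto
    have "finite (nat ` fst ` F)" using F(2) by simp
    then obtain M where M: "\<And>i. i \<in> nat ` fst ` F \<Longrightarrow> i \<le> M"
      using finite_nat_set_iff_bounded_le by metis
    \<comment> \<open>Bounding the first components suffices, as \<open>0 \<le> k \<le> n\<close> on
      \<open>coprime_pairs\<close>.\<close>
    have sub: "F \<subseteq> {0..int M} \<times> {0..int M}"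
    proof
      fix p assume p: "p \<in> F"
      obtain n k where nk: "p = (n, k)" by (cases p)
      have "nat n \<le> M" using M p nk by force
      moreover have "0 \<le> k" "k \<le> n" using F(1) p nk by (auto simp: coprime_pairs_def)
      ultimately show "p \<in> {0..int M} \<times> {0..int M}" using nk by auto
    qed
    have "(\<Sum>(n, k)\<in>F. 1 / (real_of_int (n\<^sup>2 + k\<^sup>2 + 1))\<^sup>2) \<le> (\<Sum>(n, k)\<in>F. a n * a k)"
      using le by (intro sum_mono) auto
    also have "\<dots> \<le> (\<Sum>(n, k)\<in>{0..int M} \<times> {0..int M}. a n * a k)"
      using sub a0 by (intro sum_mono2) auto
    also have "\<dots> = (\<Sum>n\<in>{0..int M}. a n) * (\<Sum>n\<in>{0..int M}. a n)"
      by (simp add: sum_product sum.cartesian_product)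
    also have "\<dots> \<le> (\<Sum>i. a (int i)) * (\<Sum>i. a (int i))"
      using partial[of M] a0 order_trans[OF sum_nonneg partial[of M]]
      by (intro mult_mono sum_nonneg) auto
    finally show "(\<Sum>(n, k)\<in>F. 1 / (real_of_int (n\<^sup>2 + k\<^sup>2 + 1))\<^sup>2) \<le> (\<Sum>i. a (int i)) * (\<Sum>i. a (int i))" .
  qed
qed auto

theorem mainTheorem2:
  fixes s t :: real
  assumes "s \<in> {1, -1}" and "t \<in> {1, -1}"
  shows "area summable_on quarter s t \<and>
    (\<lambda>(n, k). 1 / (real_of_int (n\<^sup>2 + k\<^sup>2 + 1))\<^sup>2) summable_on coprime_pairs \<and>
    (\<Sum>\<^sub>\<infinity>D\<in>quarter s t. area D) =
      pi * (\<Sum>\<^sub>\<infinity>(n, k)\<in>coprime_pairs. 1 / (real_of_int (n\<^sup>2 + k\<^sup>2 + 1))\<^sup>2)"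
proof -
  \<comment> \<open>The end disks of the quarter belong to \<open>(1, 0)\<close> and
    \<open>(1, 1)\<close>, with curvatures 2 and 3; each is counted once and in full.\<close>
  have bij: "bij_betw (quarter_disk s t) coprime_pairs (quarter s t)"
    using inj_on_quarter_disk quarter_disk_image[OF assms] by (simp add: bij_betw_def)
  let ?f = "\<lambda>(n, k). 1 / (real_of_int (n\<^sup>2 + k\<^sup>2 + 1))\<^sup>2"
  have area: "(\<lambda>p. area (quarter_disk s t p)) = (\<lambda>p. pi * ?f p)"
    by (simp add: fun_eq_iff area_quarter_disk split: prod.splits)
  have "(\<lambda>p. area (quarter_disk s t p)) summable_on coprime_pairs"
    unfolding area by (intro summable_on_cmult_right summable_on_coprime_pairs)
  then have "area summable_on quarter s t"
    using summable_on_reindex_bij_betw[OF bij, of area] by simp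
  moreover have "infsum area (quarter s t) = pi * infsum ?f coprime_pairs"
    unfolding infsum_reindex_bij_betw[OF bij, of area, symmetric] area by (rule infsum_cmult_right')
  ultimately show ?thesis using summable_on_coprime_pairs by blast
qed

end
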